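(* Define $\psi\colon\mathcal{OP}_{n,k}\to\mathcal{OP}_{n,k}$ by $\psi(\pi)=\mathsf{L}(\mathsf{read}(\varphi(\pi)))$ for $\pi\in\mathcal{OP}_{n,k}$ (written in minimaj order). Then $\psi$ is a bijection, its values are written in major index order, and $\mathsf{minimaj}(\pi)=\mathsf{maj}(\psi(\pi))$ for all $\pi\in\mathcal{OP}_{n,k}$. In particular, $\mathsf{minimaj}$ and $\mathsf{maj}$ are equidistributed on $\mathcal{OP}_{n,k}$.
   Context: $\mathcal{OP}_{n,k}$ is the set of sequences $\pi=(\pi_1\mid\cdots\mid\pi_k)$ of nonempty finite sets of positive integers with $\sum|\pi_i|=n$; $\mathcal{WOP}_{n,k}$ allows empty blocks. Minimaj order: write $\pi_k$ increasingly; for $i=k-1,\dots,1$, let $r_i$ be the largest element of $\pi_i$ that is $\leqslant$ the leftmost element of the arranged $\pi_{i+1}$; if none, arrange $\pi_i$ increasingly, else arrange increasingly and rotate cyclically so $r_i$ is rightmost. The concatenation is the minimaj word $u_1\cdots u_n$; $b_i$ is the first letter of $\pi_i$ (leading letter). $\mathsf{D}(\pi)=\{j:u_j>u_{j+1}\}$, $\mathsf{minimaj}(\pi)=\sum_{j\in\mathsf{D}(\pi)}j$; a descent at $j$ lies in block $\pi_i$ if $u_j\in\pi_i$. Major index order: each block in decreasing order; concatenated word = concatenation of blocks; descent = position $j$ with $w_j>w_{j+1}$; a block has a descent at the end if it is nonempty and its last letter is a descent. For $\pi'\in\mathcal{WOP}_{n,k}$ in major index order, the last letter of a nonempty block $\pi'_j$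 gets index $j$ and its other letters index $j-1$; $\mathsf{maj}(\pi')$ is the sum of the indices of the letters at which descents occur (for $\mathcal{OP}_{n,k}$ this is the usual major index). The map $\varphi$: if $\mathsf{D}(\pi)=\{\delta_1<\cdots<\delta_\ell\}$ and the blocks containing descents are $\pi_{\eta_1},\dots,\pi_{\eta_\ell}$ ($\eta_1<\cdots<\eta_\ell$), set $\delta_0=\eta_0=0$, $\delta_{\ell+1}=n$, $\eta_{\ell+1}=k$, $d_j=\delta_j-\delta_{j-1}$, $i_j=\eta_j-\eta_{j-1}$. Then $\varphi(\pi)=T_1\times\cdots\times T_{\ell+1}$, where for $1\leqslant j\leqslant\ell$, $T_j$ is the column (increasing top to bottom) of the non-leading letters among $u_{\delta_{\ell-j+1}+1},\dots,u_{\delta_{\ell-j+2}}$, and $T_{\ell+1}$ is the ribbon tableau of shape $(1^{d_1-i_1},i_1,\dots,i_{\ell+1})$ (rows numbered bottom to top, row $j+1$ starting in the column of the last box of row $j$) with row $d_1-i_1+j$ filled left to right by $b_{\eta_{j-1}+1},\dots,b_{\eta_j}$ and the bottom $d_1-i_1$ boxes of its first column filled, increasing top to bottom, by the non-leading letters among $u_1,\dots,u_{d_1}$. $\mathsf{read}(T_1\times\cdots\times T_{\ell+1})\in\mathcal{WOP}_{n,k}$ has as blocks the columns of $T_1,\dots,T_\ell$ followed by the columns of $T_{\ell+1}$ left to right, each column (possibly empty) one block, read bottom to top. Left shift $\mathsf{L}$ on $\pi'=\mathsf{read}(\varphi(\pi))$: let $\pi'_{p_m},\dots,\pi'_{p_1}$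 ($1\leqslant p_m<\cdots<p_1<k$, $m\geqslant0$) be the blocks that are empty or have a descent at the end. $\mathsf{L}^{(0)}(\pi')=\pi'$; for $1\leqslant i\leqslant m$, $S_i$ is the sequence of letters of $\mathsf{L}^{(i-1)}(\pi')$ starting immediately right of its $p_i$-th block up to and including the $p_i$-th descent after that block, and $\mathsf{L}^{(i)}(\pi')$ moves each letter of $S_i$ one block to the left; $\mathsf{L}(\pi')=\mathsf{L}^{(m)}(\pi')$. *)

theory Defs
  imports Main "HOL-Library.Multiset" "HOL-Library.Equipollence"
begin

text \<open>
  Blocks, positions in words and descents are numbered from 1; a word or a sequence of blocks is a
  list, so its \<open>i\<close>-th entry is found at list index \<open>i - 1\<close>.
\<close>

definition OP :: "nat \<Rightarrow> nat \<Rightarrow> nat set list set" where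
  "OP n k = {\<pi>. length \<pi> = k
              \<and> (\<forall>B \<in> set \<pi>. finite B \<and> B \<noteq> {} \<and> (\<forall>x \<in> B. 0 < x))
              \<and> sum_list (map card \<pi>) = n}"

definition content :: "nat set list \<Rightarrow> nat multiset" where
  "content \<pi> = sum_list (map mset_set \<pi>)"

definition descents :: "nat list \<Rightarrow> nat set" where
  "descents w = {j. 1 \<le> j \<and> j < length w \<and> w ! (j - 1) > w ! j}"

text \<open>
  For a sequence of words \<open>ws\<close>, \<open>block_end ws i\<close> is the position in \<open>concat ws\<close> of the last letter
  of the first \<open>i\<close> blocks, and \<open>block_of ws j\<close> is the number of the block containing the letter at
  position \<open>j\<close>. Both are meaningful when some blocks are empty.
\<close>

definition block_end :: "nat list list \<Rightarrow> nat \<Rightarrow> nat" where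
  "block_end ws i = length (concat (take i ws))"

definition block_of :: "nat list list \<Rightarrow> nat \<Rightarrow> nat" where
  "block_of ws j = (LEAST i. j \<le> block_end ws i)"


subsection \<open>Minimaj order\<close>

text \<open>
  Rotating the increasing arrangement of \<open>B\<close> to the left by the number of its elements \<open>\<le> r\<close> puts
  \<open>r\<close> in the rightmost position.
\<close>

fun minimaj_order :: "nat set list \<Rightarrow> nat list list" where
  "minimaj_order [] = []"
| "minimaj_order [B] = [sorted_list_of_set B]"
| "minimaj_order (B # C # Bs) =
     (let ws = minimaj_order (C # Bs);
          A = {x \<in> B. x \<le> hd (hd ws)}
      in (if A = {} then sorted_list_of_set B
          else (let r = Max A in rotate (card {x \<in> B. x \<le> r}) (sorted_list_of_set B))) # ws)"

definition minimaj :: "nat set list \<Rightarrow> nat" where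
  "minimaj \<pi> = \<Sum> (descents (concat (minimaj_order \<pi>)))"


subsection \<open>Major index order\<close>

definition major_index_order :: "nat set list \<Rightarrow> nat list list" where
  "major_index_order \<pi> = map (\<lambda>B. rev (sorted_list_of_set B)) \<pi>"

definition letter_index :: "nat list list \<Rightarrow> nat \<Rightarrow> nat" where
  "letter_index ws j =
     (let i = block_of ws j in if j = block_end ws i then i else i - 1)"

definition maj :: "nat set list \<Rightarrow> nat" where
  "maj \<pi> = (let ws = major_index_order \<pi> in \<Sum>j \<in> descents (concat ws). letter_index ws j)"


subsection \<open>The map \<open>\<phi>\<close>\<close>

definition delta :: "nat list list \<Rightarrow> nat \<Rightarrow> nat" where
  "delta ws j = (0 # sorted_list_of_set (descents (concat ws)) @ [length (concat ws)]) ! j"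

definition eta :: "nat list list \<Rightarrow> nat \<Rightarrow> nat" where
  "eta ws j = (0 # sorted_list_of_set (block_of ws ` descents (concat ws)) @ [length ws]) ! j"

definition leading :: "nat list list \<Rightarrow> nat set" where
  "leading ws = {block_end ws (i - 1) + 1 | i. 1 \<le> i \<and> i \<le> length ws}"

text \<open>
  \<open>nonleading ws s\<close> lists increasingly the non-leading letters at the positions
  \<open>delta ws (s - 1) + 1, \<dots>, delta ws s\<close>.
\<close>

definition nonleading :: "nat list list \<Rightarrow> nat \<Rightarrow> nat list" where
  "nonleading ws s =
     sort (map (\<lambda>j. concat ws ! (j - 1))
       (filter (\<lambda>j. j \<notin> leading ws) [delta ws (s - 1) + 1 ..< delta ws s + 1]))"

text \<open>
  A column is the list of its entries from top to bottom. A ribbon tableau is the list of its rows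
  from bottom to top, each row being read from left to right; the position of the rows relative to
  each other is given by \<open>ribbon_start\<close> below. \<open>phi \<pi>\<close> consists of the columns
  \<open>T\<^sub>1, \<dots>, T\<^sub>l\<close> and the ribbon tableau \<open>T\<^sub>l\<^sub>+\<^sub>1\<close>, whose lowest \<open>d\<^sub>1 - i\<^sub>1\<close> rows are single boxes.
\<close>

definition phi :: "nat set list \<Rightarrow> nat list list \<times> nat list list" where
  "phi \<pi> =
     (let ws = minimaj_order \<pi>;
          l = card (descents (concat ws));
          b = (\<lambda>i. hd (ws ! (i - 1)))
      in (map (\<lambda>j. nonleading ws (l - j + 2)) [1 ..< l + 1],
          map (\<lambda>x. [x]) (rev (nonleading ws 1))
            @ map (\<lambda>j. map b [eta ws (j - 1) + 1 ..< eta ws j + 1]) [1 ..< l + 2]))"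


subsection \<open>Reading\<close>

text \<open>
  Rows (from bottom to top) and columns (from left to right) of a ribbon are numbered from 0. Each
  row starts in the column of the last box of the row below it.
\<close>

definition ribbon_start :: "nat list list \<Rightarrow> nat \<Rightarrow> nat" where
  "ribbon_start R r = (\<Sum>q<r. length (R ! q) - 1)"

definition ribbon_width :: "nat list list \<Rightarrow> nat" where
  "ribbon_width R = ribbon_start R (length R - 1) + length (last R)"

definition ribbon_column :: "nat list list \<Rightarrow> nat \<Rightarrow> nat list" where
  "ribbon_column R c =
     map (\<lambda>r. R ! r ! (c - ribbon_start R r))
       (filter (\<lambda>r. ribbon_start R r \<le> c \<and> c < ribbon_start R r + length (R ! r)) [0 ..< length R])"

definition read_tableaux :: "nat list list \<times> nat list list \<Rightarrow> nat list list" where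
  "read_tableaux T = map rev (fst T) @ map (ribbon_column (snd T)) [0 ..< ribbon_width (snd T)]"


subsection \<open>Left shift\<close>

text \<open>
  The letters moved are those at the positions \<open>s + 1, \<dots>, e\<close>. If there are fewer than \<open>p\<close> descents
  after the \<open>p\<close>-th block, a case which does not arise for the sequences \<open>read_tableaux (phi \<pi>)\<close>,
  no letter is moved.
\<close>

definition left_shift_step :: "nat \<Rightarrow> nat list list \<Rightarrow> nat list list" where
  "left_shift_step p ws =
     (let w = concat ws;
          s = block_end ws p;
          ds = sorted_list_of_set {j \<in> descents w. s < j};
          e = (if p \<le> length ds then ds ! (p - 1) else s);
          new_block = (\<lambda>j. if s < j \<and> j \<le> e then block_of ws j - 1 else block_of ws j)
      in map (\<lambda>q. map (\<lambda>j. w ! (j - 1)) (filter (\<lambda>j. new_block j = q) [1 ..< length w + 1]))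
           [1 ..< length ws + 1])"

definition shift_blocks :: "nat list list \<Rightarrow> nat set" where
  "shift_blocks ws =
     {p. 1 \<le> p \<and> p < length ws \<and>
         (ws ! (p - 1) = [] \<or> ws ! (p - 1) \<noteq> [] \<and> block_end ws p \<in> descents (concat ws))}"

definition left_shift :: "nat list list \<Rightarrow> nat list list" where
  "left_shift ws = fold left_shift_step (rev (sorted_list_of_set (shift_blocks ws))) ws"


subsection \<open>The map \<open>\<psi>\<close>\<close>

text \<open>
  \<open>psi_word \<pi>\<close> records the order in which the letters of each block are written, \<open>psi \<pi>\<close> the
  underlying sequence of sets.
\<close>

definition psi_word :: "nat set list \<Rightarrow> nat list list" where
  "psi_word \<pi> = left_shift (read_tableaux (phi \<pi>))"

definition psi :: "nat set list \<Rightarrow> nat set list" where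
  "psi \<pi> = map set (psi_word \<pi>)"

end

theory Submission
  imports Defs
begin

text \<open>
  Write \<open>b\<close> for the word of leading letters of \<open>\<pi>\<close> in minimaj order. Its descents are the numbers of the
  blocks containing a descent, and \<open>\<pi>\<close> is recovered from \<open>b\<close> and the sets \<open>C\<^sub>1, \<dots>, C\<^sub>l\<^sub>+\<^sub>1\<close> of
  non-leading letters of the weakly increasing runs of the minimaj word. Reading \<open>\<phi>(\<pi>)\<close> gives the word
  \<open>w = C\<^sub>l\<^sub>+\<^sub>1 \<cdots> C\<^sub>1 b\<close> (each \<open>C\<^sub>j\<close> decreasing), divided by \<open>k - 1\<close> bars: one at every ascent of \<open>w\<close>,
  and further bars \<open>s\<^sub>1 \<le> \<dots> \<le> s\<^sub>m \<le> n - k\<close>. The left shift keeps \<open>w\<close> and the bars at the ascents, and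
  moves the bar \<open>s\<^sub>t\<close> to the \<open>(s\<^sub>t + t)\<close>-th descent of \<open>w\<close>; this is injective, and as \<open>b\<close> consists of the
  last \<open>k\<close> letters of \<open>w\<close> and has \<open>l\<close> descents, \<open>\<psi>\<close> is injective. It preserves the content, and there are
  finitely many \<open>\<pi>\<close> with given content, so \<open>\<psi>\<close> is bijective. Finally both \<open>minimaj \<pi>\<close> and
  \<open>maj (\<psi> \<pi>)\<close> equal \<open>(k - 1) (k + 2 (n - k)) / 2\<close> minus the sum of the positions of the bars of
  \<open>read (\<phi> \<pi>)\<close>.
\<close>


subsection \<open>Words divided into blocks\<close>

text \<open>Columns may be empty, so a division into blocks is encoded by its multiset of bars, and
  one step of the shift becomes the exchange of one bar for another. The number of the target comes
  from a count: if s_t is the bar after block p, then t of the first p blocks are shifted and the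
  other p - t end at the ascents up to s_t; so s_t - p + t descents are passed, and the p-th descent
  beyond has number s_t + t. As only k - 1 - m bars are taken up by ascents, w has n - k + m
  descents, and s_t \<le> n - k is what makes the target exist. Bars s_t may coincide, but the
  summand t makes the targets distinct, so no block stays empty. The constant is k (k - 1) / 2 + (n
  - k) (k - 1). The first term is the sum of the positions 1, ..., k - 1 of b, of which the descents
  enter \<open>minimaj\<close> and the ascents enter the bars. The second says that each non-leading
  letter accounts for k - 1: the descents of the minimaj word not before it and the bars of the
  reading not before it number k - 1 together. On the side of \<open>maj\<close>, pairs of a bar and
  a descent are counted, and m cancels.\<close>

lemma sorted_wrt_less_sorted_list_of_set: "sorted_wrt (<) (sorted_list_of_set (A::nat set))"
  by (simp add: strict_sorted_list_of_set)

lemma descents_subset: "descents w \<subseteq> {1..<length w}"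
  by (auto simp: descents_def)

lemma finite_descents [simp]: "finite (descents w)"
  using descents_subset finite_subset by blast

lemma block_end_0 [simp]: "block_end ws 0 = 0"
  by (simp add: block_end_def)

lemma block_end_ge_length: "length ws \<le> q \<Longrightarrow> block_end ws q = length (concat ws)"
  by (simp add: block_end_def)

lemma block_end_Suc: "q < length ws \<Longrightarrow> block_end ws (Suc q) = block_end ws q + length (ws ! q)"
  by (simp add: block_end_def take_Suc_conv_app_nth)

lemma block_end_mono: "q \<le> r \<Longrightarrow> block_end ws q \<le> block_end ws r"
proof (induction r rule: dec_induct)
  case (step r)
  then show ?case
    using block_end_Suc[of r ws] block_end_ge_length[of ws r] block_end_ge_length[of ws "Suc r"]
    by (cases "r < length ws") auto
qed simp

lemma block_end_le: "block_end ws q \<le> length (concat ws)"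
  using block_end_mono[of q "max q (length ws)" ws] block_end_ge_length[of ws "max q (length ws)"]
  by simp

text \<open>Replaces the \<open>LEAST\<close> in \<open>block_of\<close> by an adjunction with
  \<open>block_end\<close>, which remains valid when blocks are empty.\<close>

lemma block_of_le_iff:
  assumes "j \<le> length (concat ws)"
  shows "block_of ws j \<le> q \<longleftrightarrow> j \<le> block_end ws q"
proof
  assume "block_of ws j \<le> q"
  moreover have "j \<le> block_end ws (block_of ws j)"
    unfolding block_of_def
    by (rule LeastI[of _ "length ws"]) (use assms in \<open>simp add: block_end_ge_length\<close>)
  ultimately show "j \<le> block_end ws q"
    using block_end_mono le_trans by blast
qed (simp add: block_of_def Least_le)

lemma block_of_in_range:
  assumes "1 \<le> j" "j \<le> length (concat ws)"
  shows "1 \<le> block_of ws j" "block_of ws j \<le> length ws"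
proof -
  show "block_of ws j \<le> length ws"
    using block_of_le_iff[OF assms(2), of "length ws"] assms by (simp add: block_end_ge_length)
  show "1 \<le> block_of ws j"
    using block_of_le_iff[OF assms(2), of 0] assms by simp
qed

lemma block_of_bounds:
  assumes "1 \<le> j" "j \<le> length (concat ws)"
  shows "block_end ws (block_of ws j - 1) < j" "j \<le> block_end ws (block_of ws j)"
  using block_of_le_iff[OF assms(2), of "block_of ws j - 1"] block_of_le_iff[OF assms(2), of "block_of ws j"]
    block_of_in_range[OF assms]
  by auto

lemma nth_eq_take_drop_concat:
  assumes "q < length ws"
  shows "ws ! q = take (block_end ws (Suc q) - block_end ws q) (drop (block_end ws q) (concat ws))"
proof -
  have "concat ws = concat (take q ws) @ ws ! q @ concat (drop (Suc q) ws)"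
    by (metis assms concat.simps(2) concat_append id_take_nth_drop)
  then show ?thesis
    using block_end_Suc[OF assms] by (simp add: block_end_def)
qed

lemma nth_nth_concat:
  assumes "q < length ws" "i < length (ws ! q)"
  shows "ws ! q ! i = concat ws ! (block_end ws q + i)"
  using nth_eq_take_drop_concat[OF assms(1)] block_end_Suc[OF assms(1)] assms(2)
    block_end_le[of ws "Suc q"]
  by (metis add_leD1 add_diff_cancel_left' nth_drop nth_take)

text \<open>The end of the last block is left out, being the length of the word. A list rather than
  a set, because an empty block repeats a bar.\<close>

definition bars :: "nat list list \<Rightarrow> nat list" where
  "bars ws = map (block_end ws) [1..<length ws]"

lemma sorted_bars: "sorted (bars ws)"
  unfolding bars_def sorted_map
  by (rule sorted_wrt_mono_rel[of _ "(\<le>)"]) (auto simp: block_end_mono)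

text \<open>The multiset suffices because \<open>bars\<close> is sorted. So the left shift can be
  followed without tracking which bar belongs to which block.\<close>

lemma list_list_eqI:
  assumes "concat ws = concat ws'" "length ws = length ws'" "mset (bars ws) = mset (bars ws')"
  shows "ws = ws'"
proof -
  have "bars ws = bars ws'"
    by (metis assms(3) sorted_bars properties_for_sort)
  then have bend: "block_end ws q = block_end ws' q" if "q \<le> length ws" for q
    using that assms(1,2)
    by (cases "q = 0"; cases "q = length ws") (auto simp: bars_def block_end_ge_length)
  show ?thesis
  proof (rule nth_equalityI[OF assms(2)])
    fix q assume "q < length ws"
    then show "ws ! q = ws' ! q"
      using assms bend[of q] bend[of "Suc q"] by (simp add: nth_eq_take_drop_concat)
  qed
qed


subsection \<open>One step of the left shift\<close>

lemma filter_le_Suc_append: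
  fixes f :: "'a \<Rightarrow> nat"
  assumes "sorted (map f xs)"
  shows "filter (\<lambda>x. f x \<le> k) xs @ filter (\<lambda>x. f x = Suc k) xs = filter (\<lambda>x. f x \<le> Suc k) xs"
  using assms
proof (induction xs)
  case (Cons x xs)
  have "filter (\<lambda>x. f x \<le> k) xs = []" if "\<not> f x \<le> k"
    using that Cons.prems by (auto simp: filter_empty_conv)
  then show ?case
    using Cons by auto
qed simp

text \<open>A sorted labelling has its fibres in the order of the word, so regrouping by labels
  keeps the word. For the left shift the labels are the new block numbers.\<close>

lemma concat_fibres:
  fixes f :: "'a \<Rightarrow> nat"
  assumes "sorted (map f xs)" "\<forall>x \<in> set xs. 1 \<le> f x"
  shows "concat (map (\<lambda>q. map g (filter (\<lambda>x. f x = q) xs)) [1..<Suc k])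
    = map g (filter (\<lambda>x. f x \<le> k) xs)"
proof (induction k)
  case 0
  then show ?case
    using assms(2) by (auto simp: filter_empty_conv)
next
  case (Suc k)
  have "[1..<Suc (Suc k)] = [1..<Suc k] @ [Suc k]"
    by simp
  then show ?case
    using Suc arg_cong[OF filter_le_Suc_append[OF assms(1), of k], of "map g"]
    by (simp del: upt_Suc)
qed

text \<open>With \<open>f\<close> the block ends, ends up to \<open>e\<close> move down by one
  index, one end becomes \<open>e\<close>, and those beyond \<open>e\<close> stay. Only
  \<open>f p\<close> gets lost, in exchange for \<open>e\<close>.\<close>

lemma mset_map_max_min:
  fixes f :: "nat \<Rightarrow> nat"
  assumes "mono f" "p < k" "f p \<le> e" "e \<le> f k"
  shows "mset (map (\<lambda>q. max (f q) (min e (f (Suc q)))) [p..<k]) = add_mset e (mset (map f [Suc p..<k]))"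
  using assms(2,4)
proof (induction k)
  case (Suc k)
  show ?case
  proof (cases "p = k")
    case True
    then show ?thesis using Suc assms by simp
  next
    case False
    with Suc have "p < k" by simp
    show ?thesis
    proof (cases "e \<le> f k")
      case True
      then show ?thesis using Suc \<open>p < k\<close> by (simp add: max_def min_def)
    next
      case False
      have "map (\<lambda>q. max (f q) (min e (f (Suc q)))) [p..<k] = map (\<lambda>q. f (Suc q)) [p..<k]"
      proof (rule map_cong[OF refl])
        fix q assume "q \<in> set [p..<k]"
        then have "f (Suc q) \<le> f k" "f q \<le> f (Suc q)"
          using assms(1) by (auto intro: monoD)
        then show "max (f q) (min e (f (Suc q))) = f (Suc q)" using False by simp
      qed
      also have "\<dots> = map f (map Suc [p..<k])" by simp
      also have "\<dots> = map f [Suc p..<Suc k]" by (simp only: map_Suc_upt)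
      finally have 1: "map (\<lambda>q. max (f q) (min e (f (Suc q)))) [p..<k] = map f [Suc p..<Suc k]" .
      have "max (f k) (min e (f (Suc k))) = e" using False Suc.prems by simp
      then show ?thesis using 1 \<open>p < k\<close> by simp
    qed
  qed
qed simp

text \<open>The end \<open>e\<close> of the moved letters in \<open>left_shift_step\<close> without
  its default branch, which the cardinality hypotheses below exclude.\<close>

definition shift_target :: "nat list list \<Rightarrow> nat \<Rightarrow> nat" where
  "shift_target ws p = sorted_list_of_set {j \<in> descents (concat ws). block_end ws p < j} ! (p - 1)"

lemma shift_target_bounds:
  assumes "1 \<le> p" "p \<le> card {j \<in> descents (concat ws). block_end ws p < j}"
  shows "block_end ws p < shift_target ws p" "shift_target ws p \<in> descents (concat ws)"
proof -
  let ?A = "{j \<in> descents (concat ws). block_end ws p < j}"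
  have "shift_target ws p \<in> set (sorted_list_of_set ?A)"
    unfolding shift_target_def by (rule nth_mem) (use assms in simp)
  then show "block_end ws p < shift_target ws p" "shift_target ws p \<in> descents (concat ws)"
    by simp_all
qed

lemma length_filter_le_upt: "X \<le> n \<Longrightarrow> length (filter (\<lambda>j. j \<le> X) [1..<Suc n]) = X"
proof (induction n)
  case (Suc n)
  have "filter (\<lambda>j. j \<le> X) [1..<Suc (Suc n)] = [1..<Suc (Suc n)]" if "X = Suc n"
    using that by (auto simp: filter_id_conv)
  with Suc show ?case
    by (cases "X = Suc n") auto
qed simp

text \<open>A step erases the bar after block \<open>p\<close> and inserts one at the target;
  \<open>add_mset\<close> on both sides avoids subtracting multisets. That earlier block ends stay
  put lets the steps be combined from right to left.\<close>

lemma left_shift_step: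
  assumes p: "1 \<le> p" "p < length ws"
    and card: "p \<le> card {j \<in> descents (concat ws). block_end ws p < j}"
  shows "length (left_shift_step p ws) = length ws"
    and "concat (left_shift_step p ws) = concat ws"
    and "q < p \<Longrightarrow> block_end (left_shift_step p ws) q = block_end ws q"
    and "add_mset (block_end ws p) (mset (bars (left_shift_step p ws)))
      = add_mset (shift_target ws p) (mset (bars ws))"
proof -
  define w n s e where "w = concat ws" and "n = length w" and "s = block_end ws p"
    and "e = shift_target ws p"
  define nb where "nb j = (if s < j \<and> j \<le> e then block_of ws j - 1 else block_of ws j)" for j
  define ws2 where "ws2 = map (\<lambda>q. map (\<lambda>j. w ! (j - 1)) (filter (\<lambda>j. nb j = q) [1..<Suc n]))
    [1..<Suc (length ws)]"
  have step: "left_shift_step p ws = ws2"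
    using card unfolding left_shift_step_def ws2_def nb_def s_def e_def shift_target_def w_def n_def
    by (simp add: Let_def)
  have se: "s < e" "e < n" "e \<in> descents w"
    using shift_target_bounds[OF p(1) card] descents_subset[of w]
    by (auto simp: s_def e_def w_def n_def)
  \<comment> \<open>The new end of block \<open>q\<close>: up to the target, block \<open>q\<close>
    takes over the end of block \<open>q + 1\<close>; beyond the target nothing moves.\<close>
  define X where "X q = (if q < p then block_end ws q
    else max (block_end ws q) (min e (block_end ws (Suc q))))" for q
  have Xn: "X q \<le> n" for q
    using block_end_le[of ws] se by (auto simp: X_def n_def w_def)
  \<comment> \<open>This adjunction yields the range and monotonicity of \<open>nb\<close> and the
    new block ends at once.\<close>
  have nb_le: "nb j \<le> q \<longleftrightarrow> j \<le> X q" if "1 \<le> j" "j \<le> n" for j q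
  proof -
    have bo: "block_of ws j \<le> r \<longleftrightarrow> j \<le> block_end ws r" for r
      using block_of_le_iff that by (simp add: n_def w_def)
    have "Suc q \<le> p \<Longrightarrow> block_end ws (Suc q) \<le> s" "block_end ws q \<le> block_end ws (Suc q)"
      "p \<le> q \<Longrightarrow> s \<le> block_end ws q" "q \<le> p \<Longrightarrow> block_end ws q \<le> s"
      by (auto simp: s_def block_end_mono)
    moreover have "block_of ws j - 1 \<le> q \<longleftrightarrow> j \<le> block_end ws (Suc q)"
      using bo[of "Suc q"] by auto
    ultimately show ?thesis
      using bo[of q] se unfolding nb_def X_def by auto
  qed
  have nb_range: "1 \<le> nb j" "nb j \<le> length ws" if "1 \<le> j" "j \<le> n" for j
  proof -
    have "X 0 = 0" using p by (simp add: X_def)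
    then show "1 \<le> nb j" using nb_le[OF that, of 0] that by simp
    have "X (length ws) = n" using p se by (simp add: X_def block_end_ge_length n_def w_def)
    then show "nb j \<le> length ws" using nb_le[OF that, of "length ws"] that by simp
  qed
  have nb_mono: "nb i \<le> nb j" if "1 \<le> i" "i \<le> j" "j \<le> n" for i j
    using nb_le[of i "nb j"] nb_le[of j "nb j"] that by auto
  have sorted_nb: "sorted (map nb [1..<Suc n])"
    unfolding sorted_map
    by (rule sorted_wrt_mono_rel[of _ "(\<le>)"]) (use nb_mono in \<open>auto simp del: upt_Suc\<close>)
  have cf: "concat (take q ws2) = map (\<lambda>j. w ! (j - 1)) (filter (\<lambda>j. nb j \<le> q) [1..<Suc n])"
    if "q \<le> length ws" for q
  proof -
    have "take q ws2 = map (\<lambda>q. map (\<lambda>j. w ! (j - 1)) (filter (\<lambda>j. nb j = q) [1..<Suc n])) [1..<Suc q]"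
      using that by (simp add: ws2_def take_map take_upt del: upt_Suc)
    then show ?thesis
      using concat_fibres[OF sorted_nb, of "\<lambda>j. w ! (j - 1)" q] nb_range by (simp del: upt_Suc)
  qed
  show len: "length (left_shift_step p ws) = length ws"
    by (simp add: step ws2_def del: upt_Suc)
  have "concat ws2 = map (\<lambda>j. w ! (j - 1)) [1..<Suc n]"
    using cf[of "length ws"] nb_range len step by (auto simp: filter_id_conv simp del: upt_Suc)
  also have "\<dots> = w"
    by (rule nth_equalityI) (auto simp: n_def simp del: upt_Suc)
  finally show "concat (left_shift_step p ws) = concat ws"
    by (simp add: step w_def)
  have bend: "block_end ws2 q = X q" if "q \<le> length ws" for q
  proof -
    have "block_end ws2 q = length (filter (\<lambda>j. nb j \<le> q) [1..<Suc n])"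
      using cf[OF that] by (simp add: block_end_def del: upt_Suc)
    also have "filter (\<lambda>j. nb j \<le> q) [1..<Suc n] = filter (\<lambda>j. j \<le> X q) [1..<Suc n]"
      by (rule filter_cong[OF refl]) (use nb_le in auto)
    finally show ?thesis using length_filter_le_upt[OF Xn] by simp
  qed
  show "block_end (left_shift_step p ws) q = block_end ws q" if "q < p"
    using bend[of q] p that by (simp add: step X_def)
  have split: "[1..<length ws] = [1..<p] @ [p..<length ws]"
    using p by (metis upt_add_eq_append le_add_diff_inverse less_imp_le)
  have "bars ws2 = map X [1..<length ws]"
    using bend len step by (simp add: bars_def)
  also have "\<dots> = map (block_end ws) [1..<p]
      @ map (\<lambda>q. max (block_end ws q) (min e (block_end ws (Suc q)))) [p..<length ws]"
    unfolding split by (simp add: X_def)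
  finally have "mset (bars ws2) = mset (map (block_end ws) [1..<p])
      + add_mset e (mset (map (block_end ws) [Suc p..<length ws]))"
    using mset_map_max_min[of "block_end ws" p "length ws" e] p se
    by (simp add: mono_def block_end_mono s_def block_end_ge_length n_def w_def)
  moreover have "bars ws = map (block_end ws) [1..<p] @ s # map (block_end ws) [Suc p..<length ws]"
    unfolding bars_def split using p by (simp add: upt_conv_Cons s_def)
  ultimately show "add_mset (block_end ws p) (mset (bars (left_shift_step p ws)))
      = add_mset (shift_target ws p) (mset (bars ws))"
    by (simp add: step e_def s_def)
qed

text \<open>As the indices decrease, a step leaves the ends of all blocks treated later untouched,
  and the word never changes. So every target can be computed in the original
  \<open>ws\<close>.\<close>

lemma fold_left_shift_step:
  assumes "sorted_wrt (>) ps"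
    and "\<forall>p \<in> set ps. 1 \<le> p \<and> p < length ws
      \<and> p \<le> card {j \<in> descents (concat ws). block_end ws p < j}"
  shows "length (fold left_shift_step ps ws) = length ws \<and>
    concat (fold left_shift_step ps ws) = concat ws \<and>
    mset (map (block_end ws) ps) + mset (bars (fold left_shift_step ps ws))
      = mset (map (shift_target ws) ps) + mset (bars ws)"
  using assms
proof (induction ps arbitrary: ws)
  case (Cons p ps)
  let ?ws1 = "left_shift_step p ws"
  note step = left_shift_step[of p ws]
  have bend: "block_end ?ws1 q = block_end ws q" if "q \<in> set ps" for q
    using Cons.prems that step(3)[of q] by auto
  have conc: "concat ?ws1 = concat ws" "length ?ws1 = length ws"
    using Cons.prems step by auto
  have st: "shift_target ?ws1 q = shift_target ws q" if "q \<in> set ps" for q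
    using bend[OF that] conc by (simp add: shift_target_def)
  have "\<forall>p \<in> set ps. 1 \<le> p \<and> p < length ?ws1
      \<and> p \<le> card {j \<in> descents (concat ?ws1). block_end ?ws1 p < j}"
    using Cons.prems conc bend by simp
  from Cons.IH[OF _ this] Cons.prems(1)
  have IH: "length (fold left_shift_step ps ?ws1) = length ws"
    "concat (fold left_shift_step ps ?ws1) = concat ws"
    "mset (map (block_end ?ws1) ps) + mset (bars (fold left_shift_step ps ?ws1))
      = mset (map (shift_target ?ws1) ps) + mset (bars ?ws1)"
    by (simp_all add: conc)
  have maps: "map (block_end ?ws1) ps = map (block_end ws) ps"
    "map (shift_target ?ws1) ps = map (shift_target ws) ps"
    using bend st by simp_all
  have "add_mset (block_end ws p) (mset (map (block_end ws) ps) + mset (bars (fold left_shift_step ps ?ws1)))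
    = mset (map (shift_target ws) ps) + add_mset (block_end ws p) (mset (bars ?ws1))"
    using IH(3) by (simp only: maps) simp
  also have "\<dots> = mset (map (shift_target ws) ps) + add_mset (shift_target ws p) (mset (bars ws))"
    using step(4) Cons.prems by simp
  finally show ?case using IH(1,2) by simp
qed simp


subsection \<open>Left shift of decreasing blocks\<close>

lemma sorted_list_of_set_append:
  fixes A B :: "nat set"
  assumes "finite A" "finite B" "\<And>a b. a \<in> A \<Longrightarrow> b \<in> B \<Longrightarrow> a < b"
  shows "sorted_list_of_set (A \<union> B) = sorted_list_of_set A @ sorted_list_of_set B"
proof (rule sorted_distinct_set_unique)
  show "sorted (sorted_list_of_set A @ sorted_list_of_set B)"
    using assms by (auto simp: sorted_append less_imp_le)
  show "distinct (sorted_list_of_set A @ sorted_list_of_set B)"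
    using assms(1,2) by (auto dest: assms(3))
qed (use assms in auto)

lemma sorted_list_of_set_greater:
  fixes A :: "nat set"
  assumes "finite A"
  shows "sorted_list_of_set {x \<in> A. s < x} = drop (card {x \<in> A. x \<le> s}) (sorted_list_of_set A)"
proof -
  have "A = {x \<in> A. x \<le> s} \<union> {x \<in> A. s < x}" by auto
  then have "sorted_list_of_set A = sorted_list_of_set {x \<in> A. x \<le> s} @ sorted_list_of_set {x \<in> A. s < x}"
    using sorted_list_of_set_append[of "{x \<in> A. x \<le> s}" "{x \<in> A. s < x}"] assms by auto
  then show ?thesis by simp
qed

lemma sorted_list_of_set_nth_le_iff:
  fixes A :: "nat set"
  assumes "i < card A" "j < card A"
  shows "sorted_list_of_set A ! i \<le> sorted_list_of_set A ! j \<longleftrightarrow> i \<le> j"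
proof -
  have "sorted_list_of_set A ! a < sorted_list_of_set A ! b" if "a < b" "b < card A" for a b
    using sorted_wrt_nth_less[OF sorted_wrt_less_sorted_list_of_set[of A], of a b] that by simp
  then show ?thesis
    by (metis assms leD leI nat_less_le)
qed

lemma sorted_list_of_set_nth_eq_iff:
  fixes A :: "nat set"
  assumes "i < card A" "j < card A"
  shows "sorted_list_of_set A ! i = sorted_list_of_set A ! j \<longleftrightarrow> i = j"
  using sorted_list_of_set_nth_le_iff[OF assms] sorted_list_of_set_nth_le_iff[OF assms(2,1)] by auto

lemma image_nth_sorted_list_of_set:
  "finite (A :: nat set) \<Longrightarrow> (!) (sorted_list_of_set A) ` {..<card A} = A"
  by (metis lessThan_atLeast0 list.set_map map_nth set_upt sorted_list_of_set.length_sorted_key_list_of_set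
      sorted_list_of_set.set_sorted_key_list_of_set)

lemma inj_on_nth_sorted_list_of_set:
  "inj_on ((!) (sorted_list_of_set (A :: nat set))) {..<card A}"
  by (auto simp: inj_on_def sorted_list_of_set_nth_eq_iff)

lemma card_le_nth_sorted_list_of_set:
  fixes A :: "nat set"
  assumes "finite A" "i < card A"
  shows "card {x \<in> A. x \<le> sorted_list_of_set A ! i} = Suc i"
proof -
  let ?f = "(!) (sorted_list_of_set A)"
  have "{x \<in> A. x \<le> ?f i} = {x \<in> ?f ` {..<card A}. x \<le> ?f i}"
    using image_nth_sorted_list_of_set[OF assms(1)] by simp
  also have "\<dots> = ?f ` {..i}"
    using assms(2) by (auto simp: sorted_list_of_set_nth_le_iff)
  finally show ?thesis
    using card_image[OF inj_on_subset[OF inj_on_nth_sorted_list_of_set[of A], of "{..i}"]] assms(2)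
    by force
qed

lemma card_ge_nth_sorted_list_of_set:
  fixes A :: "nat set"
  assumes "finite A" "i < card A"
  shows "card {x \<in> A. sorted_list_of_set A ! i \<le> x} = card A - i"
proof -
  let ?f = "(!) (sorted_list_of_set A)"
  have "{x \<in> A. ?f i \<le> x} = {x \<in> ?f ` {..<card A}. ?f i \<le> x}"
    using image_nth_sorted_list_of_set[OF assms(1)] by simp
  also have "\<dots> = ?f ` {i..<card A}"
    using assms(2) by (auto simp: sorted_list_of_set_nth_le_iff)
  finally show ?thesis
    using card_image[OF inj_on_subset[OF inj_on_nth_sorted_list_of_set[of A], of "{i..<card A}"]]
    by force
qed

lemma sum_nth_sorted_list_of_set:
  fixes A :: "nat set"
  assumes "finite A"
  shows "sum f A = (\<Sum>i<card A. f (sorted_list_of_set A ! i))"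
  using sum.reindex[OF inj_on_nth_sorted_list_of_set[of A], of f] image_nth_sorted_list_of_set[OF assms]
  by simp

lemma mset_sorted_list_of_set: "mset (sorted_list_of_set A) = mset_set A"
  by (metis mset_sorted_list_of_multiset sorted_list_of_mset_set)

lemma card_filter_eq_sum: "finite A \<Longrightarrow> card {x \<in> A. P x} = (\<Sum>x\<in>A. if P x then 1 else 0)"
  by (simp only: card_eq_sum sum.inter_filter)

section \<open>Bars, ascents and letter indices\<close>

text \<open>Weak ascents: equal neighbouring letters count, since a strictly decreasing block cannot
  contain them.\<close>

definition ascents :: "nat list \<Rightarrow> nat set" where
  "ascents w = {1..<length w} - descents w"

text \<open>A position strictly between two consecutive block ends is not a bar, so a block
  decreases strictly exactly when no ascent lies inside it.\<close>

lemma decreasing_blocks_iff: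
  "(\<forall>v \<in> set ws. sorted_wrt (>) v) \<longleftrightarrow> ascents (concat ws) \<subseteq> set (bars ws)"
proof
  assume dec: "\<forall>v \<in> set ws. sorted_wrt (>) v"
  show "ascents (concat ws) \<subseteq> set (bars ws)"
  proof (rule subsetI, rule ccontr)
    fix j assume j: "j \<in> ascents (concat ws)" and nb: "j \<notin> set (bars ws)"
    have jn: "1 \<le> j" "j < length (concat ws)" using j by (auto simp: ascents_def)
    define q where "q = block_of ws j - 1"
    have q: "q < length ws" "block_end ws q < j" "j \<le> block_end ws (Suc q)"
      using block_of_in_range[of j ws] block_of_bounds[of j ws] jn by (auto simp: q_def)
    have "j \<noteq> block_end ws (Suc q)"
      using nb jn q by (cases "Suc q < length ws") (auto simp: bars_def block_end_ge_length)
    define i where "i = j - block_end ws q - 1"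
    have i: "Suc i < length (ws ! q)" "block_end ws q + i = j - 1" "block_end ws q + Suc i = j"
      using q \<open>j \<noteq> _\<close> block_end_Suc[of q ws] by (auto simp: i_def)
    have "ws ! q ! Suc i < ws ! q ! i"
      using dec q(1) i(1) sorted_wrt_nth_less[of "(>)" "ws ! q" i "Suc i"] by simp
    then have "concat ws ! j < concat ws ! (j - 1)"
      using nth_nth_concat[of q ws i] nth_nth_concat[of q ws "Suc i"] q i by simp
    then show False using j jn by (simp add: ascents_def descents_def)
  qed
next
  assume sub: "ascents (concat ws) \<subseteq> set (bars ws)"
  have "ws ! q ! Suc i < ws ! q ! i" if q: "q < length ws" and i: "Suc i < length (ws ! q)" for q i
  proof -
    define j where "j = block_end ws q + Suc i"
    have "j < block_end ws (Suc q)" using block_end_Suc[OF q] i by (simp add: j_def)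
    moreover have "block_end ws q < j" by (simp add: j_def)
    ultimately have "j \<noteq> block_end ws r" for r
      using block_end_mono[of r q ws] block_end_mono[of "Suc q" r ws] by (cases "r \<le> q") auto
    then have "j \<notin> ascents (concat ws)" using sub by (auto simp: bars_def)
    then have "j \<in> descents (concat ws)"
      using \<open>j < block_end ws (Suc q)\<close> block_end_le[of ws "Suc q"] by (auto simp: ascents_def j_def)
    then show ?thesis
      using nth_nth_concat[of q ws i] nth_nth_concat[of q ws "Suc i"] q i
      by (simp add: descents_def j_def)
  qed
  then show "\<forall>v \<in> set ws. sorted_wrt (>) v"
    by (auto simp: in_set_conv_nth sorted_wrt_iff_nth_Suc_transp)
qed

text \<open>An empty inner block repeats a bar; an empty first or last block puts a bar at 0 or at
  the end of the word.\<close>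

lemma nonempty_blocksI:
  assumes "distinct (bars ws)" "set (bars ws) \<subseteq> {1..<length (concat ws)}" "concat ws \<noteq> []"
  shows "[] \<notin> set ws"
proof
  assume "[] \<in> set ws"
  then obtain q where q: "q < length ws" "ws ! q = []" by (auto simp: in_set_conv_nth)
  then have eq: "block_end ws (Suc q) = block_end ws q" by (simp add: block_end_Suc)
  have inj: "inj_on (block_end ws) {1..<length ws}"
    using assms(1) by (simp add: bars_def distinct_map)
  have rng: "1 \<le> block_end ws r" "block_end ws r < length (concat ws)" if "1 \<le> r" "r < length ws" for r
    using assms(2) that by (force simp: bars_def image_subset_iff)+
  have "length (concat ws) > 0" using assms(3) by blast
  have "q \<noteq> 0"
  proof
    assume "q = 0"
    then show False
      using eq rng[of 1] \<open>length (concat ws) > 0\<close> q block_end_ge_length[of ws 1]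
      by (cases "length ws = 1") (auto simp del: length_concat length_greater_0_conv)
  qed
  moreover have "Suc q \<noteq> length ws"
    using eq rng[of q] calculation block_end_ge_length[of ws "Suc q"] by auto
  ultimately show False
    using inj_onD[OF inj eq] q(1) by auto
qed

lemma block_end_strict_mono:
  assumes "[] \<notin> set ws" "q < r" "r \<le> length ws"
  shows "block_end ws q < block_end ws r"
proof -
  have "ws ! q \<noteq> []" using assms by (metis less_le_trans nth_mem)
  then have "block_end ws q < block_end ws (Suc q)"
    using block_end_Suc[of q ws] assms by simp
  then show ?thesis using block_end_mono[of "Suc q" r ws] assms by simp
qed

text \<open>A letter of block \<open>i\<close> has \<open>i - 1\<close> bars before it, and the last
  letter also meets the bar ending its own block. So \<open>maj\<close> counts pairs of a bar and a
  descent not before it.\<close>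

lemma letter_index_eq_card:
  assumes "[] \<notin> set ws" "1 \<le> x" "x < length (concat ws)"
  shows "letter_index ws x = card {a \<in> set (bars ws). a \<le> x}"
proof -
  note mono = block_end_strict_mono[OF assms(1)]
  define i where "i = block_of ws x"
  have i: "1 \<le> i" "i \<le> length ws" "block_end ws (i - 1) < x" "x \<le> block_end ws i"
    using block_of_in_range[of x ws] block_of_bounds[of x ws] assms by (auto simp: i_def)
  have inj: "inj_on (block_end ws) {1..<length ws}"
    using mono by (intro inj_onI) (metis atLeastLessThan_iff less_imp_le nat_neq_iff)
  have "{a \<in> set (bars ws). a \<le> x} = block_end ws ` {q \<in> {1..<length ws}. block_end ws q \<le> x}"
    by (auto simp: bars_def)
  then have "card {a \<in> set (bars ws). a \<le> x} = card {q \<in> {1..<length ws}. block_end ws q \<le> x}"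
    using card_image[OF inj_on_subset[OF inj], of "{q \<in> {1..<length ws}. block_end ws q \<le> x}"]
    by force
  also have "{q \<in> {1..<length ws}. block_end ws q \<le> x} = {1..(if x = block_end ws i then i else i - 1)}"
  proof -
    have "block_end ws q \<le> x \<longleftrightarrow> q \<le> (if x = block_end ws i then i else i - 1)"
      if "1 \<le> q" "q < length ws" for q
    proof (cases "q \<le> i - 1")
      case True
      then show ?thesis using block_end_mono[of q "i - 1" ws] i by auto
    next
      case False
      then have "q = i \<or> i < q" by linarith
      then show ?thesis using mono[of i q] i that by auto
    qed
    moreover have "i < length ws" if "x = block_end ws i"
      using that assms(3) i block_end_ge_length[of ws i] by (cases "i < length ws") auto
    ultimately show ?thesis using i by (auto split: if_splits)
  qed
  finally show ?thesis by (simp add: letter_index_def i_def Let_def)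
qed

lemma major_index_order_map_set:
  assumes "\<forall>v \<in> set ws. sorted_wrt (>) v"
  shows "major_index_order (map set ws) = ws"
proof -
  have "rev (sorted_list_of_set (set v)) = v" if "v \<in> set ws" for v
  proof -
    have "sorted_wrt (<) (rev v)" using assms that by (simp add: sorted_wrt_rev)
    then have "sorted_list_of_set (set v) = rev v"
      by (metis set_rev sorted_list_of_set.idem_if_sorted_distinct strict_sorted_iff)
    then show ?thesis by simp
  qed
  then show ?thesis by (simp add: major_index_order_def map_idI)
qed

section \<open>The left shift as a whole\<close>

text \<open>Here \<open>M\<close> is \<open>maj\<close>, \<open>B\<close> the sum of the bars,
  \<open>SA\<close>, \<open>SD\<close>, \<open>S\<close> the sums of the ascents, the descents and
  the \<open>s i\<close>, and \<open>d\<close>, \<open>m\<close> the numbers of descents and of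
  shifted blocks. Elimination gives \<open>n * n - n - (d - m) * (d - m) - (d - m)\<close>, where
  \<open>d - m = N\<close> does not depend on \<open>m\<close>.\<close>

lemma shift_sum_identity:
  fixes M a c t d m :: nat
  assumes "M = a + c" "a + t = SD" "2 * t = d * d + d" "c + (S + I) = m * d" "2 * I + m = m * m"
    "B = SA + S" "2 * (SA + SD) + n = n * n" "d = N + m" "n = N + k" "1 \<le> k"
  shows "2 * (M + B) = (k - 1) * (k + 2 * N)"
proof -
  obtain l where k: "k = Suc l" using assms(10) by (cases k) auto
  have "2 * (M + B) + n + (d * d + d) + m * m = n * n + 2 * (m * d) + m"
    using assms(1-7) by algebra
  then show ?thesis
    unfolding assms(8,9) k by (simp add: algebra_simps)
qed

text \<open>
  Here \<open>N\<close> is \<open>n - k\<close>, the number of letters of \<open>read (\<phi> \<pi>)\<close> preceding the leading letters.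
\<close>

locale shiftable =
  fixes ws :: "nat list list" and N :: nat
  assumes decreasing: "\<forall>v \<in> set ws. sorted_wrt (>) v"
    and nonempty: "ws \<noteq> []" "last ws \<noteq> []"
    and length_word: "length (concat ws) = N + length ws"
    and shift_block_end_le: "p \<in> shift_blocks ws \<Longrightarrow> block_end ws p \<le> N"
begin

abbreviation "k \<equiv> length ws"
abbreviation "n \<equiv> length (concat ws)"
abbreviation "D \<equiv> descents (concat ws)"
abbreviation "A \<equiv> ascents (concat ws)"
abbreviation "SB \<equiv> shift_blocks ws"
abbreviation "m \<equiv> card SB"
abbreviation "s i \<equiv> block_end ws (sorted_list_of_set SB ! i)"

text \<open>The blocks before the last one that are not shifted: they are nonempty and end at an
  ascent.\<close>

definition NS :: "nat set" where
  "NS = {1..<k} - SB"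

lemma SB_subset: "SB \<subseteq> {1..<k}"
  by (auto simp: shift_blocks_def)

lemma finite_SB [simp]: "finite SB"
  using SB_subset finite_subset by blast

lemma finite_NS [simp]: "finite NS"
  by (simp add: NS_def)

lemma k_pos: "1 \<le> k"
  using nonempty by (cases ws) auto

lemma block_end_less: "p < k \<Longrightarrow> block_end ws p < n"
proof -
  assume "p < k"
  have "ws ! (k - 1) \<noteq> []" using nonempty by (simp add: last_conv_nth)
  then have "block_end ws (k - 1) < block_end ws k"
    using block_end_Suc[of "k - 1" ws] nonempty(1) by simp
  moreover have "p \<le> k - 1" using \<open>p < k\<close> by simp
  ultimately show ?thesis
    using block_end_mono[of p "k - 1" ws] by (simp add: block_end_ge_length)
qed

lemma NS_less:
  assumes "q < p" "p \<in> NS"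
  shows "block_end ws q < block_end ws p"
proof -
  have p: "1 \<le> p" "p < k" "ws ! (p - 1) \<noteq> []"
    using assms by (auto simp: NS_def shift_blocks_def)
  then have "block_end ws (p - 1) < block_end ws p"
    using block_end_Suc[of "p - 1" ws] by simp
  moreover have "q \<le> p - 1" using assms by simp
  ultimately show ?thesis using block_end_mono[of q "p - 1" ws] by simp
qed

lemma inj_on_NS: "inj_on (block_end ws) NS"
  by (rule inj_onI) (metis NS_less nat_neq_iff)

text \<open>An ascent is a bar because the blocks decrease. Of the blocks ending there, the first is
  nonempty, hence in \<open>NS\<close>; any others are empty and belong to
  \<open>SB\<close>.\<close>

lemma image_NS: "block_end ws ` NS = A"
proof
  show "block_end ws ` NS \<subseteq> A"
  proof
    fix a assume "a \<in> block_end ws ` NS"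
    then obtain p where p: "p \<in> NS" "a = block_end ws p" by auto
    then have "0 < a" using NS_less[of 0 p] by (auto simp: NS_def)
    moreover have "a < n" using p block_end_less by (auto simp: NS_def)
    moreover have "a \<notin> D" using p by (auto simp: NS_def shift_blocks_def)
    ultimately show "a \<in> A" by (auto simp: ascents_def)
  qed
  show "A \<subseteq> block_end ws ` NS"
  proof
    fix a assume a: "a \<in> A"
    then have "a \<in> set (bars ws)"
      using decreasing decreasing_blocks_iff[of ws] by blast
    then obtain q where q: "1 \<le> q" "q < k" "a = block_end ws q"
      by (auto simp: bars_def)
    have an: "1 \<le> a" "a < n" "a \<notin> D" using a by (auto simp: ascents_def)
    define p where "p = block_of ws a"
    have "p \<le> q" using block_of_le_iff[of a ws q] an q by (simp add: p_def)
    have p: "1 \<le> p" "block_end ws (p - 1) < a" "a \<le> block_end ws p"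
      using block_of_in_range[of a ws] block_of_bounds[of a ws] an by (auto simp: p_def)
    have "block_end ws p = a" using block_end_mono[OF \<open>p \<le> q\<close>, of ws] p q by simp
    moreover have "ws ! (p - 1) \<noteq> []"
      using p \<open>block_end ws p = a\<close> block_end_Suc[of "p - 1" ws] \<open>p \<le> q\<close> q by auto
    ultimately show "a \<in> block_end ws ` NS"
      using p q an \<open>p \<le> q\<close> by (auto simp: NS_def shift_blocks_def intro!: image_eqI[of _ _ p])
  qed
qed

lemma mset_bars: "mset (bars ws) = mset_set A + mset (map s [0..<m])"
proof -
  have "mset (bars ws) = image_mset (block_end ws) (mset_set {1..<k})"
    by (simp add: bars_def)
  also have "{1..<k} = NS \<union> SB" using SB_subset by (auto simp: NS_def)
  also have "image_mset (block_end ws) (mset_set (NS \<union> SB))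
      = image_mset (block_end ws) (mset_set NS) + image_mset (block_end ws) (mset_set SB)"
    by (subst mset_set_Union) (auto simp: NS_def)
  also have "image_mset (block_end ws) (mset_set NS) = mset_set A"
    using image_mset_mset_set[OF inj_on_NS] image_NS by simp
  also have "mset_set SB = mset (sorted_list_of_set SB)"
    by (simp add: mset_sorted_list_of_set)
  also have "sorted_list_of_set SB = map ((!) (sorted_list_of_set SB)) [0..<m]"
    by (metis map_nth sorted_list_of_set.length_sorted_key_list_of_set)
  finally show ?thesis by (simp add: image_mset.compositionality comp_def flip: mset_map)
qed

text \<open>With \<open>m\<close> of the \<open>k - 1\<close> bars shifted, \<open>k - 1 - m\<close>
  ascents remain among the \<open>n - 1\<close> positions, and all other positions are
  descents.\<close>

lemma card_D: "card D = N + m"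
proof -
  have "card NS = card A" using card_image[OF inj_on_NS] image_NS by simp
  moreover have "card NS = (k - 1) - m" "m \<le> k - 1"
    using card_Diff_subset[OF finite_SB SB_subset] card_mono[OF _ SB_subset] by (auto simp: NS_def)
  moreover have "card A = (n - 1) - card D" "card D \<le> n - 1"
    using card_Diff_subset[OF finite_descents descents_subset, of "concat ws"]
      card_mono[OF _ descents_subset, of "concat ws"] by (auto simp: ascents_def)
  ultimately show ?thesis using length_word k_pos by linarith
qed

lemma nth_SB: "i < m \<Longrightarrow> sorted_list_of_set SB ! i \<in> SB"
  by (metis finite_SB nth_mem sorted_list_of_set.length_sorted_key_list_of_set
      sorted_list_of_set.set_sorted_key_list_of_set)

lemma s_le: "i < m \<Longrightarrow> s i \<le> N"
  using nth_SB shift_block_end_le by blast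

text \<open>
  Among the first \<open>p\<close> blocks, those which are not shifted end exactly at the ascents up to \<open>s i\<close>.
\<close>

lemma card_descents_le:
  assumes "i < m" "p = sorted_list_of_set SB ! i"
  shows "card {x \<in> D. x \<le> block_end ws p} + p = block_end ws p + Suc i"
proof -
  let ?s = "block_end ws p"
  have p: "p \<in> SB" "1 \<le> p" "p < k" "?s \<le> N" using nth_SB assms SB_subset s_le by force+
  have "{a \<in> A. a \<le> ?s} = block_end ws ` {q \<in> NS. q \<le> p}"
    unfolding image_NS[symmetric] using NS_less block_end_mono[of _ p ws]
    by (auto simp: not_less[symmetric])
  then have 1: "card {a \<in> A. a \<le> ?s} = card {q \<in> NS. q \<le> p}"
    using card_image[OF inj_on_subset[OF inj_on_NS], of "{q \<in> NS. q \<le> p}"] by auto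
  have "{1..p} = {q \<in> NS. q \<le> p} \<union> {q \<in> SB. q \<le> p}"
    using p SB_subset by (auto simp: NS_def)
  then have "card {1..p} = card ({q \<in> NS. q \<le> p} \<union> {q \<in> SB. q \<le> p})" by simp
  also have "\<dots> = card {q \<in> NS. q \<le> p} + card {q \<in> SB. q \<le> p}"
    by (rule card_Un_disjoint) (auto simp: NS_def)
  finally have 2: "p = card {q \<in> NS. q \<le> p} + Suc i"
    using card_le_nth_sorted_list_of_set[OF finite_SB assms(1)] assms(2) by simp
  \<comment> \<open>The bound \<open>?s \<le> N < n\<close> keeps the interval among the positions
    that ascents and descents partition.\<close>
  have "{1..?s} = {x \<in> D. x \<le> ?s} \<union> {a \<in> A. a \<le> ?s}"
    using p length_word k_pos descents_subset[of "concat ws"] by (auto simp: ascents_def)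
  then have "card {1..?s} = card ({x \<in> D. x \<le> ?s} \<union> {a \<in> A. a \<le> ?s})" by simp
  also have "\<dots> = card {x \<in> D. x \<le> ?s} + card {a \<in> A. a \<le> ?s}"
    by (rule card_Un_disjoint) (auto simp: ascents_def)
  finally show ?thesis using 1 2 by simp
qed

text \<open>List indices start at 0: for t = \<open>i + 1\<close> and s_t = \<open>s i\<close> this
  is the descent with number s_t + t.\<close>

definition e :: "nat \<Rightarrow> nat" where
  "e i = sorted_list_of_set D ! (s i + i)"

text \<open>The targets exist: there are \<open>N + m\<close> descents, while
  \<open>s i \<le> N\<close> and \<open>i < m\<close>.\<close>

lemma s_add_less: "i < m \<Longrightarrow> s i + i < card D"
  using s_le card_D by fastforce

lemma s_mono: "i \<le> j \<Longrightarrow> j < m \<Longrightarrow> s i \<le> s j"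
  by (simp add: block_end_mono sorted_list_of_set_nth_le_iff)

text \<open>The \<open>s i\<close> increase only weakly, as empty blocks repeat them; the added
  \<open>i\<close> makes the targets strictly increasing.\<close>

lemma e_le_iff: "i < m \<Longrightarrow> j < m \<Longrightarrow> e i \<le> e j \<longleftrightarrow> i \<le> j"
  using s_add_less s_mono[of i j] s_mono[of j i]
  by (cases "i \<le> j") (auto simp: e_def sorted_list_of_set_nth_le_iff)

lemma e_in_D: "i < m \<Longrightarrow> e i \<in> D"
  using image_nth_sorted_list_of_set[OF finite_descents, of "concat ws"] s_add_less
  by (auto simp: e_def)

lemma sorted_e: "sorted_wrt (<) (map e [0..<m])"
  unfolding sorted_wrt_map
  by (rule sorted_wrt_mono_rel[of _ "(<)"]) (auto simp: e_le_iff simp flip: not_le)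

lemma inj_on_e: "inj_on e {..<m}"
  by (rule inj_onI) (metis e_le_iff lessThan_iff nle_le)

abbreviation "E \<equiv> e ` {..<m}"

text \<open>By \<open>card_descents_le\<close> there are \<open>s i + i + 1 - p\<close> descents up
  to \<open>s i\<close>; counting on by \<open>p\<close> leads to a rank in which \<open>p\<close>
  no longer occurs.\<close>

lemma shift_target_eq:
  assumes "i < m" "p = sorted_list_of_set SB ! i"
  shows "shift_target ws p = e i" "p \<le> card {j \<in> D. block_end ws p < j}"
proof -
  let ?c = "card {x \<in> D. x \<le> block_end ws p}"
  note c = card_descents_le[OF assms]
  have eq: "sorted_list_of_set {j \<in> D. block_end ws p < j} = drop ?c (sorted_list_of_set D)"
    using sorted_list_of_set_greater by simp
  have "1 \<le> p" using nth_SB assms SB_subset by force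
  then have "?c + (p - 1) = s i + i" using c assms(2) by simp
  moreover have "?c \<le> card D" by (rule card_mono) auto
  ultimately show "shift_target ws p = e i"
    unfolding shift_target_def eq e_def by (simp add: nth_drop)
  have "card {j \<in> D. block_end ws p < j} = card D - ?c"
    using arg_cong[OF eq, of length] by simp
  then show "p \<le> card {j \<in> D. block_end ws p < j}"
    using c s_add_less[OF assms(1)] assms(2) by simp
qed

text \<open>The targets are descents, so \<open>E\<close> is disjoint from \<open>A\<close> and the
  new bars form a set. Containing \<open>A\<close>, they leave the blocks decreasing; being
  distinct, they leave none empty.\<close>

lemma left_shift:
  shows "length (left_shift ws) = k"
    and "concat (left_shift ws) = concat ws"
    and "mset (bars (left_shift ws)) = mset_set (A \<union> E)"
proof -
  let ?T = "sorted_list_of_set SB"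
  have T: "?T = map ((!) ?T) [0..<m]"
    by (metis map_nth sorted_list_of_set.length_sorted_key_list_of_set)
  have "sorted_wrt (>) (rev ?T)"
    using sorted_wrt_less_sorted_list_of_set[of SB] by (simp add: sorted_wrt_rev)
  moreover have "1 \<le> p \<and> p < k \<and> p \<le> card {j \<in> D. block_end ws p < j}" if "p \<in> set (rev ?T)" for p
  proof -
    have "p \<in> SB" using that by simp
    then obtain i where "i < m" "p = ?T ! i"
      using image_nth_sorted_list_of_set[OF finite_SB] by blast
    then show ?thesis using shift_target_eq[of i p] \<open>p \<in> SB\<close> SB_subset by auto
  qed
  ultimately have f: "length (left_shift ws) = k" "concat (left_shift ws) = concat ws"
    "mset (map (block_end ws) (rev ?T)) + mset (bars (left_shift ws))
      = mset (map (shift_target ws) (rev ?T)) + mset (bars ws)"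
    using fold_left_shift_step[of "rev ?T" ws] unfolding left_shift_def by blast+
  then show "length (left_shift ws) = k" "concat (left_shift ws) = concat ws" by blast+
  have "mset (map (block_end ws) (rev ?T)) = mset (map s [0..<m])"
    by (subst T) (simp add: comp_def flip: rev_map)
  moreover have "mset (map (shift_target ws) (rev ?T)) = mset (map e [0..<m])"
  proof -
    have "map (shift_target ws) ?T = map e [0..<m]"
      by (subst T) (simp add: shift_target_eq)
    then show ?thesis by (simp del: mset_map add: mset_rev flip: rev_map)
  qed
  moreover have "mset (map e [0..<m]) = mset_set E"
    using image_mset_mset_set[OF inj_on_e] by (simp add: lessThan_atLeast0)
  ultimately have "mset (bars (left_shift ws)) = mset_set A + mset_set E"
    using f(3) mset_bars by simp
  also have "\<dots> = mset_set (A \<union> E)"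
    by (subst mset_set_Union) (use e_in_D in \<open>auto simp: ascents_def\<close>)
  finally show "mset (bars (left_shift ws)) = mset_set (A \<union> E)" .
qed

lemma finite_A [simp]: "finite A"
  by (simp add: ascents_def)

lemma set_bars_left_shift: "set (bars (left_shift ws)) = A \<union> E"
  by (metis left_shift(3) finite_A finite_UnI finite_imageI finite_lessThan finite_set_mset_mset_set set_mset_mset)

lemma A_Un_E_subset: "A \<union> E \<subseteq> {1..<n}"
  using e_in_D descents_subset[of "concat ws"] by (auto simp: ascents_def)

text \<open>Makes the shift reversible: the targets can be read off from the new bars and the
  word.\<close>

lemma E_eq: "E = (A \<union> E) \<inter> D"
  using e_in_D by (auto simp: ascents_def)

lemma left_shift_decreasing: "\<forall>v \<in> set (left_shift ws). sorted_wrt (>) v"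
  unfolding decreasing_blocks_iff set_bars_left_shift left_shift(2) by blast

lemma left_shift_nonempty: "[] \<notin> set (left_shift ws)"
proof (rule nonempty_blocksI)
  show "distinct (bars (left_shift ws))"
    by (metis left_shift(3) distinct_sorted_list_of_set mset_eq_imp_distinct_iff
        finite_A finite_UnI finite_imageI finite_lessThan mset_sorted_list_of_set)
  show "set (bars (left_shift ws)) \<subseteq> {1..<length (concat (left_shift ws))}"
    using A_Un_E_subset by (simp only: set_bars_left_shift left_shift(2))
  show "concat (left_shift ws) \<noteq> []"
    using length_word nonempty(1) unfolding left_shift(2) by (metis add_is_0 length_0_conv)
qed

lemma maj_left_shift:
  "2 * (maj (map set (left_shift ws)) + sum_list (bars ws)) = (k - 1) * (k + 2 * N)"
proof -
  have "maj (map set (left_shift ws)) = (\<Sum>x\<in>D. letter_index (left_shift ws) x)"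
    by (simp add: maj_def Let_def major_index_order_map_set[OF left_shift_decreasing] left_shift(2))
  also have "\<dots> = (\<Sum>x\<in>D. card {a \<in> A \<union> E. a \<le> x})"
  proof (rule sum.cong[OF refl])
    fix x assume "x \<in> D"
    then show "letter_index (left_shift ws) x = card {a \<in> A \<union> E. a \<le> x}"
      using letter_index_eq_card[OF left_shift_nonempty, of x] descents_subset[of "concat ws"]
      by (auto simp: set_bars_left_shift left_shift(2))
  qed
  also have "\<dots> = (\<Sum>x\<in>D. card {a \<in> A. a \<le> x} + card {a \<in> E. a \<le> x})"
  proof (rule sum.cong[OF refl])
    fix x
    have "{a \<in> A \<union> E. a \<le> x} = {a \<in> A. a \<le> x} \<union> {a \<in> E. a \<le> x}" by auto
    then show "card {a \<in> A \<union> E. a \<le> x} = card {a \<in> A. a \<le> x} + card {a \<in> E. a \<le> x}"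
      using e_in_D by (auto intro!: card_Un_disjoint simp: ascents_def)
  qed
  finally have maj: "maj (map set (left_shift ws))
      = (\<Sum>x\<in>D. card {a \<in> A. a \<le> x}) + (\<Sum>x\<in>D. card {a \<in> E. a \<le> x})"
    by (simp add: sum.distrib)
  \<comment> \<open>A descent \<open>x\<close> of rank \<open>r\<close> has \<open>x - r\<close>
    ascents up to it, and the ranks run from 1 to \<open>card D\<close>.\<close>
  have 1: "(\<Sum>x\<in>D. card {a \<in> A. a \<le> x}) + (\<Sum>i<card D. Suc i) = \<Sum>D"
  proof -
    have "card {a \<in> A. a \<le> x} + card {y \<in> D. y \<le> x} = x" if "x \<in> D" for x
    proof -
      have "{1..x} = {a \<in> A. a \<le> x} \<union> {y \<in> D. y \<le> x}"
        using that descents_subset[of "concat ws"] by (auto simp: ascents_def)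
      then have "card {1..x} = card ({a \<in> A. a \<le> x} \<union> {y \<in> D. y \<le> x})" by simp
      also have "\<dots> = card {a \<in> A. a \<le> x} + card {y \<in> D. y \<le> x}"
        by (rule card_Un_disjoint) (auto simp: ascents_def)
      finally show ?thesis by simp
    qed
    then have "(\<Sum>x\<in>D. card {a \<in> A. a \<le> x}) + (\<Sum>x\<in>D. card {y \<in> D. y \<le> x}) = \<Sum>D"
      by (simp flip: sum.distrib)
    moreover have "(\<Sum>x\<in>D. card {y \<in> D. y \<le> x}) = (\<Sum>i<card D. Suc i)"
      using sum_nth_sorted_list_of_set[OF finite_descents, of "\<lambda>x. card {y \<in> D. y \<le> x}" "concat ws"]
      by (simp add: card_le_nth_sorted_list_of_set)
    ultimately show ?thesis by simp
  qed
  \<comment> \<open>Double counting: from the target \<open>e i\<close> onwards there are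
    \<open>card D - (s i + i)\<close> descents.\<close>
  have 2: "(\<Sum>x\<in>D. card {a \<in> E. a \<le> x}) + (\<Sum>i<m. s i + i) = m * card D"
  proof -
    have "(\<Sum>x\<in>D. card {a \<in> E. a \<le> x}) = (\<Sum>x\<in>D. \<Sum>a\<in>E. if a \<le> x then 1 else 0)"
      by (simp add: card_filter_eq_sum)
    also have "\<dots> = (\<Sum>a\<in>E. \<Sum>x\<in>D. if a \<le> x then 1 else 0)"
      by (rule sum.swap)
    also have "\<dots> = (\<Sum>a\<in>E. card {x \<in> D. a \<le> x})"
      by (simp add: card_filter_eq_sum)
    also have "\<dots> = (\<Sum>i<m. card {x \<in> D. e i \<le> x})"
      using sum.reindex[OF inj_on_e] by simp
    also have "\<dots> = (\<Sum>i<m. card D - (s i + i))"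
      by (rule sum.cong[OF refl]) (simp add: e_def card_ge_nth_sorted_list_of_set s_add_less)
    finally have "(\<Sum>x\<in>D. card {a \<in> E. a \<le> x}) + (\<Sum>i<m. s i + i)
        = (\<Sum>i<m. (card D - (s i + i)) + (s i + i))"
      by (simp add: sum.distrib)
    also have "\<dots> = (\<Sum>i<m. card D)"
      by (rule sum.cong[OF refl]) (use s_add_less in \<open>simp add: less_imp_le\<close>)
    finally show ?thesis by simp
  qed
  have 3: "sum_list (bars ws) = \<Sum>A + (\<Sum>i<m. s i)"
    using arg_cong[OF mset_bars, of sum_mset]
    by (simp add: sum_mset_sum_list sum_unfold_sum_mset lessThan_atLeast0)
  have 4: "\<Sum>A + \<Sum>D = \<Sum>{1..<n}"
    using sum.subset_diff[OF descents_subset, of "concat ws" "\<lambda>x. x"]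
    by (simp add: ascents_def)
  have tri: "2 * (\<Sum>i<j. i) + j = j * j" for j :: nat
    by (induction j) auto
  have "\<Sum>{1..<n} = (\<Sum>i<n. i)"
    by (rule sum.mono_neutral_left) auto
  then have 4: "2 * (\<Sum>A + \<Sum>D) + n = n * n" using 4 tri[of n] by simp
  have "2 * (\<Sum>i<card D. Suc i) = card D * card D + card D"
    using tri[of "card D"] by (simp add: sum_Suc)
  moreover have "2 * (\<Sum>i<m. i) + m = m * m" by (rule tri)
  moreover have "(\<Sum>i<m. s i + i) = (\<Sum>i<m. s i) + (\<Sum>i<m. i)" by (rule sum.distrib)
  ultimately show ?thesis
    using maj 1 2 3 4 card_D length_word k_pos
    by (intro shift_sum_identity[where SA = "\<Sum>A" and SD = "\<Sum>D" and S = "\<Sum>i<m. s i"]) simp_all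
qed

end

text \<open>The bars at descents give \<open>E\<close>, its increasing enumeration gives each
  \<open>e i\<close>, and the rank of \<open>e i\<close> among the descents minus \<open>i\<close>
  gives \<open>s i\<close>; with the ascents these are all the original bars.\<close>

lemma left_shift_inject:
  assumes "shiftable ws N" "shiftable ws' N'" "left_shift ws = left_shift ws'"
  shows "ws = ws'"
proof -
  interpret a: shiftable ws N by fact
  interpret b: shiftable ws' N' by fact
  have conc: "concat ws = concat ws'" and len: "length ws = length ws'"
    using a.left_shift b.left_shift assms(3) by metis+
  have "N = N'" using a.length_word b.length_word conc len by simp
  then have m: "a.m = b.m" using a.card_D b.card_D conc by simp
  have "a.A \<union> a.E = b.A \<union> b.E"
    using a.set_bars_left_shift b.set_bars_left_shift assms(3) by simp
  then have "a.E = b.E"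
    using a.E_eq b.E_eq conc by simp
  then have "set (map a.e [0..<a.m]) = set (map b.e [0..<b.m])"
    by (simp add: lessThan_atLeast0)
  then have "map a.e [0..<a.m] = map b.e [0..<b.m]"
    using a.sorted_e b.sorted_e strict_sorted_equal by blast
  then have "a.e i = b.e i" if "i < a.m" for i
    using that m by (metis add_0 diff_zero length_map length_upt nth_map_upt)
  then have "a.s i = b.s i" if "i < a.m" for i
    using that m a.s_add_less[of i] b.s_add_less[of i] conc
    by (force simp: a.e_def b.e_def sorted_list_of_set_nth_eq_iff)
  then have "map a.s [0..<a.m] = map b.s [0..<b.m]" using m by simp
  then have "mset (bars ws) = mset (bars ws')"
    using a.mset_bars b.mset_bars conc by simp
  then show ?thesis using list_list_eqI conc len by blast
qed


subsection \<open>Runs and ribbons\<close>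

text \<open>Maximal runs of letters whose neighbours satisfy \<open>P\<close>: for
  \<open>(\<le>)\<close> the rows of a ribbon, for \<open>(>)\<close> its columns read from bottom
  to top.\<close>

fun runs :: "(nat \<Rightarrow> nat \<Rightarrow> bool) \<Rightarrow> nat list \<Rightarrow> nat list list" where
  "runs P [] = []"
| "runs P [x] = [[x]]"
| "runs P (x # y # xs) =
     (if P x y then (x # hd (runs P (y # xs))) # tl (runs P (y # xs)) else [x] # runs P (y # xs))"

lemma runs_Cons:
  "xs \<noteq> [] \<Longrightarrow> runs P (x # xs) =
     (if P x (hd xs) then (x # hd (runs P xs)) # tl (runs P xs) else [x] # runs P xs)"
  by (cases xs) auto

lemma runs_ne: "xs \<noteq> [] \<Longrightarrow> runs P xs \<noteq> []"
  by (induction P xs rule: runs.induct) auto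

lemma concat_runs: "concat (runs P xs) = xs"
proof (induction P xs rule: runs.induct)
  case (3 P x y xs)
  then show ?case
    using runs_ne[of "y # xs" P] by (cases "runs P (y # xs)") auto
qed auto

lemma Nil_notin_runs: "[] \<notin> set (runs P xs)"
proof (induction P xs rule: runs.induct)
  case (3 P x y xs)
  then show ?case
    using runs_ne[of "y # xs" P] by (cases "runs P (y # xs)") auto
qed auto

lemma hd_runs_ne: "xs \<noteq> [] \<Longrightarrow> hd (runs P xs) \<noteq> []"
  by (metis Nil_notin_runs hd_in_set runs_ne)

lemma ribbon_start_Cons:
  "ribbon_start (a # R) (Suc r) = length a - 1 + ribbon_start R r"
  by (simp add: ribbon_start_def sum.lessThan_Suc_shift del: sum.lessThan_Suc)

lemma ribbon_start_0 [simp]: "ribbon_start R 0 = 0"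
  by (simp add: ribbon_start_def)

lemma upt_0_Suc_map: "[0..<Suc r] = 0 # map Suc [0..<r]"
  by (simp add: upt_conv_Cons map_Suc_upt del: upt_Suc)

text \<open>The last box of the bottom row \<open>a\<close> lies under the first column of the other
  rows, so at \<open>c = length a - 1\<close> both parts contribute.\<close>

lemma ribbon_column_Cons:
  "ribbon_column (a # R) c = (if c < length a then [a ! c] else []) @
     (if length a - 1 \<le> c then ribbon_column R (c - (length a - 1)) else [])"
proof -
  have "filter (\<lambda>r. ribbon_start (a # R) (Suc r) \<le> c \<and> c < ribbon_start (a # R) (Suc r) + length (R ! r)) [0..<length R]
    = (if length a - 1 \<le> c then
        filter (\<lambda>r. ribbon_start R r \<le> c - (length a - 1) \<and>
          c - (length a - 1) < ribbon_start R r + length (R ! r)) [0..<length R] else [])"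
    by (auto simp: ribbon_start_Cons filter_empty_conv intro!: filter_cong)
  moreover have "c - ribbon_start (a # R) (Suc r) = c - (length a - 1) - ribbon_start R r" for r
    by (simp add: ribbon_start_Cons)
  ultimately show ?thesis
    by (simp add: ribbon_column_def upt_0_Suc_map filter_map comp_def del: upt_Suc)
qed

lemma ribbon_width_Cons:
  "R \<noteq> [] \<Longrightarrow> ribbon_width (a # R) = length a - 1 + ribbon_width R"
  by (cases R) (auto simp: ribbon_width_def ribbon_start_Cons)

definition ribbon_columns :: "nat list list \<Rightarrow> nat list list" where
  "ribbon_columns R = map (ribbon_column R) [0..<ribbon_width R]"

lemma ribbon_columns_Cons_Cons:
  assumes "a \<noteq> []"
  shows "ribbon_columns ((x # a) # R) = [x] # ribbon_columns (a # R)"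
proof -
  have w: "ribbon_width ((x # a) # R) = Suc (ribbon_width (a # R))"
    using assms by (cases "R = []") (simp_all add: ribbon_width_Cons, simp add: ribbon_width_def)
  have "ribbon_column ((x # a) # R) 0 = [x]"
    using assms by (simp add: ribbon_column_Cons)
  moreover have "ribbon_column ((x # a) # R) (Suc c) = ribbon_column (a # R) c" for c
    using assms by (cases a) (auto simp: ribbon_column_Cons)
  ultimately show ?thesis
    by (simp add: ribbon_columns_def w upt_0_Suc_map comp_def del: upt_Suc)
qed

lemma ribbon_columns_singleton_Cons:
  assumes "R \<noteq> []" "[] \<notin> set R"
  shows "ribbon_columns ([x] # R) = (x # hd (ribbon_columns R)) # tl (ribbon_columns R)"
proof -
  have w: "ribbon_width ([x] # R) = ribbon_width R"
    using assms by (simp add: ribbon_width_Cons)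
  have "last R \<noteq> []" using assms last_in_set[of R] by metis
  then have "ribbon_width R > 0" by (simp add: ribbon_width_def)
  then obtain z where z: "ribbon_width R = Suc z" by (cases "ribbon_width R") auto
  have "ribbon_column ([x] # R) 0 = x # ribbon_column R 0"
    "ribbon_column ([x] # R) (Suc c) = ribbon_column R (Suc c)" for c
    by (auto simp: ribbon_column_Cons)
  then show ?thesis
    by (simp add: ribbon_columns_def w z upt_0_Suc_map comp_def del: upt_Suc)
qed

text \<open>A letter prepended to the word either extends the bottom row to the left, forming a
  column of its own, or, if larger than its successor, is a new bottom row under the first column.
  The first case extends a row, the second a column.\<close>

lemma ribbon_columns_runs:
  "xs \<noteq> [] \<Longrightarrow> ribbon_columns (runs (\<le>) xs) = runs (>) xs"
proof (induction xs rule: list_nonempty_induct)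
  case (single x)
  then show ?case
    by (simp add: ribbon_columns_def ribbon_width_def ribbon_column_def)
next
  case (cons x xs)
  obtain a R where aR: "runs (\<le>) xs = a # R" "a \<noteq> []"
    using runs_ne[OF cons(1), of "(\<le>)"] hd_runs_ne[OF cons(1), of "(\<le>)"] by (cases "runs (\<le>) xs") auto
  show ?case
    using cons aR ribbon_columns_Cons_Cons[of a x R] ribbon_columns_singleton_Cons[of "a # R" x]
      Nil_notin_runs[of "(\<le>)" xs]
    by (auto simp: runs_Cons)
qed

text \<open>Each single box at the bottom of the ribbon is a weakly increasing run by itself, so the
  rows of the whole ribbon come from one word.\<close>

lemma runs_descending_append:
  assumes "sorted_wrt (>) xs" "ys \<noteq> []" "\<forall>x \<in> set xs. hd ys < x"
  shows "runs (\<le>) (xs @ ys) = map (\<lambda>x. [x]) xs @ runs (\<le>) ys"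
  using assms
proof (induction xs)
  case (Cons x xs)
  have "hd (xs @ ys) < x" using Cons.prems by (cases xs) auto
  then show ?case using Cons by (simp add: runs_Cons)
qed simp

section \<open>Bars, ascents and descents of composed words\<close>

lemma bars_Cons: "ws \<noteq> [] \<Longrightarrow> bars (v # ws) = length v # map ((+) (length v)) (bars ws)"
proof -
  assume "ws \<noteq> []"
  then obtain z where z: "length ws = Suc z" by (cases ws) auto
  have "block_end (v # ws) (Suc q) = length v + block_end ws q" for q
    by (simp add: block_end_def)
  moreover have "[1..<length (v # ws)] = map Suc [0..<length ws]"
    by (simp add: map_Suc_upt del: upt_Suc)
  ultimately have "bars (v # ws) = map (\<lambda>q. length v + block_end ws q) [0..<length ws]"
    by (simp add: bars_def comp_def del: upt_Suc)
  then show ?thesis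
    by (simp add: bars_def z upt_conv_Cons del: upt_Suc)
qed

lemma length_bars: "length (bars ws) = length ws - 1"
  by (simp add: bars_def)

lemma distinct_bars: "[] \<notin> set ws \<Longrightarrow> distinct (bars ws)"
  unfolding bars_def distinct_map
  by (auto intro!: inj_onI) (metis block_end_strict_mono less_imp_le less_irrefl nat_neq_iff)

lemma sum_list_bars_Cons:
  "sum_list (bars (v # ws)) = length v * length ws + sum_list (bars ws)"
proof (cases "ws = []")
  case False
  have "sum_list (map ((+) c) xs) = c * length xs + sum_list xs" for c :: nat and xs
    by (induction xs) auto
  with False show ?thesis
    by (cases "length ws") (auto simp: bars_Cons length_bars)
qed (simp add: bars_def)

lemma descents_append:
  "descents (xs @ ys) = descents xs \<union>
     (if xs \<noteq> [] \<and> ys \<noteq> [] \<and> hd ys < last xs then {length xs} else {}) \<union>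
     (\<lambda>j. length xs + j) ` descents ys"
proof (rule set_eqI)
  fix j
  consider "j < length xs" | "j = length xs" | i where "j = length xs + Suc i"
    by (metis add_Suc_right less_imp_Suc_add not_less_iff_gr_or_eq)
  then show "j \<in> descents (xs @ ys) \<longleftrightarrow> j \<in> descents xs \<union>
     (if xs \<noteq> [] \<and> ys \<noteq> [] \<and> hd ys < last xs then {length xs} else {}) \<union>
     (\<lambda>j. length xs + j) ` descents ys"
  proof cases
    case 1
    then show ?thesis by (auto simp: descents_def nth_append)
  next
    case 2
    then show ?thesis
      by (cases "xs = []"; cases "ys = []")
        (auto simp: descents_def nth_append last_conv_nth hd_conv_nth Suc_le_eq)
  next
    case 3
    then show ?thesis by (auto simp: descents_def nth_append image_iff)
  qed
qed

lemma descents_sorted: "sorted xs \<Longrightarrow> descents xs = {}"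
  by (auto simp: descents_def) (metis One_nat_def diff_le_self leD sorted_nth_mono)

lemma descents_Cons:
  "xs \<noteq> [] \<Longrightarrow> descents (x # xs) = (if hd xs < x then {1} else {}) \<union> Suc ` descents xs"
  using descents_append[of "[x]" xs] by (simp add: descents_sorted)

lemma Suc_notin_descents: "Suc 0 \<notin> Suc ` descents xs"
  by (auto simp: descents_def)

lemma ascents_Cons:
  assumes "xs \<noteq> []"
  shows "ascents (x # xs) = (if hd xs < x then {} else {1}) \<union> Suc ` ascents xs"
proof -
  have "{1..<length (x # xs)} = insert 1 (Suc ` {1..<length xs})"
    using assms by (cases xs) auto
  moreover have "1 \<notin> Suc ` {1..<length xs}" by auto
  ultimately show ?thesis
    using Suc_notin_descents[of xs]
    by (auto simp: ascents_def descents_Cons[OF assms] image_set_diff[OF inj_Suc]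
        simp del: image_Suc_atLeastLessThan)
qed

lemma finite_ascents [simp]: "finite (ascents w)"
  by (simp add: ascents_def)

text \<open>Decreasing runs are maximal, so they are cut at ascents only, and the inclusion in
  \<open>decreasing_blocks_iff\<close> becomes an equality.\<close>

lemma set_bars_runs: "xs \<noteq> [] \<Longrightarrow> set (bars (runs (>) xs)) = ascents xs"
proof (induction xs rule: list_nonempty_induct)
  case (single x)
  then show ?case by (simp add: bars_def ascents_def)
next
  case (cons x xs)
  obtain a R where aR: "runs (>) xs = a # R"
    using runs_ne[OF cons(1), of "(>)"] by (cases "runs (>) xs") auto
  have 1: "bars ((x # a) # R) = map Suc (bars (a # R))"
    by (cases "R = []") (auto simp: bars_Cons, simp add: bars_def)
  have 2: "bars ([x] # a # R) = 1 # map Suc (bars (a # R))"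
    using bars_Cons[of "a # R" "[x]"] by simp
  show ?case
    using cons aR by (auto simp: runs_Cons ascents_Cons 1 2)
qed

lemma length_runs: "xs \<noteq> [] \<Longrightarrow> length (runs (>) xs) = Suc (card (ascents xs))"
  using set_bars_runs[of xs] distinct_bars[OF Nil_notin_runs, of "(>)" xs] length_bars[of "runs (>) xs"]
    runs_ne[of xs "(>)"]
  by (metis One_nat_def Suc_pred distinct_card length_greater_0_conv)

lemma sum_list_bars_runs: "xs \<noteq> [] \<Longrightarrow> sum_list (bars (runs (>) xs)) = \<Sum>(ascents xs)"
  using set_bars_runs[of xs] distinct_bars[OF Nil_notin_runs, of "(>)" xs]
  by (metis distinct_sum_list_conv_Sum)

lemma ascents_descending_append:
  assumes "sorted_wrt (>) xs" "ys \<noteq> []" "\<forall>x \<in> set xs. hd ys < x"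
  shows "ascents (xs @ ys) = (+) (length xs) ` ascents ys"
  using assms
proof (induction xs)
  case (Cons x xs)
  have "hd (xs @ ys) < x" using Cons.prems by (cases xs) auto
  then show ?case using Cons by (auto simp: ascents_Cons image_image)
qed simp

lemma card_ascents: "card (ascents w) + card (descents w) = length w - 1"
  using card_Diff_subset[OF finite_descents descents_subset, of w] card_mono[OF _ descents_subset, of w]
  by (simp add: ascents_def)

lemma sum_ascents: "\<Sum>(ascents w) + \<Sum>(descents w) = \<Sum>{1..<length w}"
  using sum.subset_diff[OF descents_subset, of w "\<lambda>x. x"] by (simp add: ascents_def)


subsection \<open>Leading letters and columns\<close>

text \<open>
  \<open>leads \<pi>\<close> lists the leading letters of \<open>\<pi>\<close> in minimaj order, and \<open>col_sets \<pi>\<close> the sets of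
  non-leading letters of the maximal weakly increasing runs of the minimaj word.
\<close>

fun leads :: "nat set list \<Rightarrow> nat list" where
  "leads [] = []"
| "leads [B] = [Min B]"
| "leads (B # C # Bs) =
     (let b = leads (C # Bs); H = {x \<in> B. hd b < x}
      in (if H = {} then Min B else Min H) # b)"

fun col_sets :: "nat set list \<Rightarrow> nat set list" where
  "col_sets [] = []"
| "col_sets [B] = [B - {Min B}]"
| "col_sets (B # C # Bs) =
     (let c = hd (leads (C # Bs)); Cs = col_sets (C # Bs); H = {x \<in> B. c < x}
      in (if H = {} then ((B - {Min B}) \<union> hd Cs) # tl Cs
          else (H - {Min H}) # ({x \<in> B. x \<le> c} \<union> hd Cs) # tl Cs))"

text \<open>The empty sequence is excluded because the recursion starts from one block; it is
  treated separately in \<open>psi_OP\<close>.\<close>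

definition ordered_blocks :: "nat set list \<Rightarrow> bool" where
  "ordered_blocks \<pi> \<longleftrightarrow> \<pi> \<noteq> [] \<and> (\<forall>B \<in> set \<pi>. finite B \<and> B \<noteq> {})"

lemma leads_Cons:
  "Bs \<noteq> [] \<Longrightarrow> leads (B # Bs) =
     (if {x \<in> B. hd (leads Bs) < x} = {} then Min B else Min {x \<in> B. hd (leads Bs) < x}) # leads Bs"
  by (cases Bs) (auto simp: Let_def)

lemma length_leads [simp]: "length (leads \<pi>) = length \<pi>"
  by (induction \<pi> rule: leads.induct) (auto simp: Let_def)

lemma leads_ne [simp]: "leads \<pi> = [] \<longleftrightarrow> \<pi> = []"
  by (metis length_0_conv length_leads)

lemma col_sets_ne: "\<pi> \<noteq> [] \<Longrightarrow> col_sets \<pi> \<noteq> []"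
  by (induction \<pi> rule: leads.induct) (auto simp: Let_def)

text \<open>
  In case \<open>low\<close> the first block contains no descent; in case \<open>high\<close> its letters up to the descent form
  the set \<open>H\<close>, and those after it the set \<open>L\<close>.
\<close>

lemma ordered_blocks_induct [consumes 1, case_names single low high]:
  assumes "ordered_blocks \<pi>"
    and single: "\<And>B. finite B \<Longrightarrow> B \<noteq> {} \<Longrightarrow> P [B]"
    and low: "\<And>B Bs c X T. finite B \<Longrightarrow> B \<noteq> {} \<Longrightarrow> ordered_blocks Bs \<Longrightarrow> P Bs \<Longrightarrow>
      c = hd (leads Bs) \<Longrightarrow> col_sets Bs = X # T \<Longrightarrow> \<forall>x \<in> B. x \<le> c \<Longrightarrow> \<forall>x \<in> X. c < x \<Longrightarrow> finite X \<Longrightarrow>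
      leads (B # Bs) = Min B # leads Bs \<Longrightarrow>
      col_sets (B # Bs) = ((B - {Min B}) \<union> X) # T \<Longrightarrow> P (B # Bs)"
    and high: "\<And>B Bs c X T H L. finite H \<Longrightarrow> H \<noteq> {} \<Longrightarrow> finite L \<Longrightarrow> B = H \<union> L \<Longrightarrow> ordered_blocks Bs \<Longrightarrow>
      P Bs \<Longrightarrow> c = hd (leads Bs) \<Longrightarrow> col_sets Bs = X # T \<Longrightarrow> \<forall>x \<in> H. c < x \<Longrightarrow> \<forall>x \<in> L. x \<le> c \<Longrightarrow>
      \<forall>x \<in> X. c < x \<Longrightarrow> finite X \<Longrightarrow>
      leads (B # Bs) = Min H # leads Bs \<Longrightarrow>
      col_sets (B # Bs) = (H - {Min H}) # (L \<union> X) # T \<Longrightarrow> P (B # Bs)"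
  shows "P \<pi>"
proof -
  have "\<pi> \<noteq> []" using assms(1) by (simp add: ordered_blocks_def)
  \<comment> \<open>The bound on \<open>hd (col_sets \<pi>)\<close> is carried along: it puts
    \<open>X\<close> above \<open>c\<close>, which separates it from the letters of the new block
    that join the same run.\<close>
  then have "ordered_blocks \<pi> \<Longrightarrow>
    P \<pi> \<and> (\<forall>x \<in> hd (col_sets \<pi>). hd (leads \<pi>) < x) \<and> finite (hd (col_sets \<pi>))"
  proof (induction \<pi> rule: list_nonempty_induct)
    case (single B)
    then show ?case
      using assms(2) by (auto simp: ordered_blocks_def le_neq_implies_less)
  next
    case (cons B Bs)
    have B: "finite B" "B \<noteq> {}" and Bs: "ordered_blocks Bs"
      using cons by (auto simp: ordered_blocks_def)
    obtain X T where XT: "col_sets Bs = X # T" using col_sets_ne[OF cons(1)] by (cases "col_sets Bs") auto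
    define c where "c = hd (leads Bs)"
    have X: "\<forall>x \<in> X. c < x" "finite X" and P: "P Bs" using cons Bs XT by (auto simp: c_def)
    obtain C Bs' where Bs': "Bs = C # Bs'" using cons(1) by (cases Bs) auto
    define H L where "H = {x \<in> B. c < x}" and "L = {x \<in> B. x \<le> c}"
    show ?case
    proof (cases "H = {}")
      case True
      have l: "leads (B # Bs) = Min B # leads Bs"
        using leads_Cons[OF cons(1), of B] True by (simp add: H_def c_def)
      have cs: "col_sets (B # Bs) = ((B - {Min B}) \<union> X) # T"
        using True XT by (auto simp: Bs' Let_def H_def c_def)
      have le: "\<forall>x \<in> B. x \<le> c" using True by (auto simp: H_def)
      then have "P (B # Bs)"
        by (intro low[OF B Bs P c_def XT _ X l cs])
      moreover have "Min B < x" if "x \<in> (B - {Min B}) \<union> X" for x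
        using that B X le Min_in[OF B] Min_le[OF B(1), of x]
        by (metis Diff_iff Un_iff insertCI le_less_trans le_neq_implies_less)
      ultimately show ?thesis using B X by (simp add: l cs)
    next
      case False
      have H: "finite H" "finite L" "B = H \<union> L" using B by (auto simp: H_def L_def)
      have l: "leads (B # Bs) = Min H # leads Bs"
        using False unfolding leads_Cons[OF cons(1)] H_def c_def by (simp only: if_False)
      have cs: "col_sets (B # Bs) = (H - {Min H}) # (L \<union> X) # T"
        using False XT by (auto simp: Bs' Let_def H_def c_def L_def)
      have "P (B # Bs)"
        by (rule high[OF H(1) False H(2,3) Bs P c_def XT _ _ X l cs]) (auto simp: H_def L_def)
      moreover have "Min H < x" if "x \<in> H - {Min H}" for x
        using that Min_le[OF H(1), of x] by (auto simp: le_neq_implies_less)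
      ultimately show ?thesis using H(1) by (simp add: l cs)
    qed
  qed
  then show ?thesis using assms(1) by blast
qed

lemma ordered_blocks_ne: "ordered_blocks \<pi> \<Longrightarrow> \<pi> \<noteq> []"
  by (simp add: ordered_blocks_def)

lemma Min_high_greater: "finite H \<Longrightarrow> H \<noteq> {} \<Longrightarrow> \<forall>x \<in> H. c < x \<Longrightarrow> c < Min (H :: nat set)"
  by simp

lemma Min_low_le: "finite B \<Longrightarrow> B \<noteq> {} \<Longrightarrow> \<forall>x \<in> B. x \<le> c \<Longrightarrow> Min (B :: nat set) \<le> c"
  by simp

lemma hd_col_sets_greater: "ordered_blocks \<pi> \<Longrightarrow> \<forall>x \<in> hd (col_sets \<pi>). hd (leads \<pi>) < x"
proof (induction \<pi> rule: ordered_blocks_induct)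
  case (single B)
  then show ?case by (simp add: le_neq_implies_less)
next
  case (low B Bs c X T)
  have "Min B \<le> c" using low.hyps by (intro Min_low_le)
  then have "Min B < x" if "x \<in> (B - {Min B}) \<union> X" for x
    using that low.hyps(7) Min_le[OF low.hyps(1), of x] by (cases "x \<in> X") (auto simp: le_neq_implies_less)
  then show ?case by (simp add: low.hyps(9,10))
next
  case (high B Bs c X T H L)
  have "Min H < x" if "x \<in> H - {Min H}" for x
    using that Min_le[OF high.hyps(1), of x] by (auto simp: le_neq_implies_less)
  then show ?case by (simp add: high.hyps(12,13))
qed

lemma finite_col_sets: "ordered_blocks \<pi> \<Longrightarrow> C \<in> set (col_sets \<pi>) \<Longrightarrow> finite C"
  by (induction \<pi> rule: ordered_blocks_induct) auto

text \<open>Comparing \<open>b\<close> with \<open>c\<close> tells whether the first block contains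
  a descent. The run shared with later blocks is divided at \<open>c\<close>, since the letters that
  later blocks contribute to it exceed \<open>c\<close>.\<close>

fun recover :: "nat list \<Rightarrow> nat set list \<Rightarrow> nat set list" where
  "recover [] Cs = []"
| "recover [b] Cs = [insert b (hd Cs)]"
| "recover (b # c # bs) Cs =
     (if b \<le> c
      then insert b {x \<in> hd Cs. x \<le> c} # recover (c # bs) ({x \<in> hd Cs. c < x} # tl Cs)
      else (insert b (hd Cs) \<union> {x \<in> hd (tl Cs). x \<le> c})
        # recover (c # bs) ({x \<in> hd (tl Cs). c < x} # tl (tl Cs)))"

lemma recover_leads_col_sets: "ordered_blocks \<pi> \<Longrightarrow> recover (leads \<pi>) (col_sets \<pi>) = \<pi>"
proof (induction \<pi> rule: ordered_blocks_induct)
  case (single B)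
  then show ?case by (simp add: insert_absorb)
next
  case (low B Bs c X T)
  obtain bs where bs: "leads Bs = c # bs"
    using low ordered_blocks_ne[of Bs] by (cases "leads Bs") auto
  have f: "{x \<in> (B - {Min B}) \<union> X. x \<le> c} = B - {Min B}" "{x \<in> (B - {Min B}) \<union> X. c < x} = X"
    using low.hyps(6,7) by fastforce+
  have le: "Min B \<le> c" using low.hyps by (intro Min_low_le)
  have "recover (leads (B # Bs)) (col_sets (B # Bs)) = insert (Min B) (B - {Min B}) # recover (c # bs) (X # T)"
    by (simp only: low.hyps(9,10) bs recover.simps le if_True list.sel f)
  then show ?case
    using low.IH bs low.hyps(1,2,5) by (simp add: insert_absorb)
next
  case (high B Bs c X T H L)
  obtain bs where bs: "leads Bs = c # bs"
    using high ordered_blocks_ne[of Bs] by (cases "leads Bs") auto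
  have f: "{x \<in> L \<union> X. x \<le> c} = L" "{x \<in> L \<union> X. c < x} = X"
    using high.hyps(9,10) by fastforce+
  have gt: "\<not> Min H \<le> c" using high.hyps Min_high_greater[of H c] by (simp add: not_le)
  have "recover (leads (B # Bs)) (col_sets (B # Bs))
      = (insert (Min H) (H - {Min H}) \<union> L) # recover (c # bs) (X # T)"
    by (simp only: high.hyps(12,13) bs recover.simps gt if_False list.sel f)
  then show ?case
    using high.IH bs high.hyps(1,2,4,7) by (simp add: insert_absorb)
qed

lemma content_Nil [simp]: "content [] = {#}"
  and content_Cons [simp]: "content (B # Bs) = mset_set B + content Bs"
  by (simp_all add: content_def)

text \<open>No multiplicity is lost in the unions forming \<open>col_sets\<close>: the letters
  joining a run are at most \<open>c\<close>, those already there are larger.\<close>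

lemma content_col_sets:
  "ordered_blocks \<pi> \<Longrightarrow> content (col_sets \<pi>) + mset (leads \<pi>) = content \<pi>"
proof (induction \<pi> rule: ordered_blocks_induct)
  case (single B)
  then show ?case using mset_set.remove[of B "Min B"] by simp
next
  case (low B Bs c X T)
  have 1: "mset_set ((B - {Min B}) \<union> X) = mset_set (B - {Min B}) + mset_set X"
    by (rule mset_set_Union) (use low.hyps(1,6,7,8) in fastforce)+
  have 2: "mset_set B = add_mset (Min B) (mset_set (B - {Min B}))"
    using low.hyps by (intro mset_set.remove) auto
  have 3: "content Bs = mset_set X + content T + mset (leads Bs)"
    using low.IH low.hyps(5) by simp
  show ?case
    by (simp add: low.hyps(9,10) 1 2 3 add_ac)
next
  case (high B Bs c X T H L)
  have 1: "mset_set (L \<union> X) = mset_set L + mset_set X" "mset_set (H \<union> L) = mset_set H + mset_set L"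
  proof -
    have "L \<inter> X = {}" "H \<inter> L = {}" using high.hyps(8-10) by fastforce+
    then show "mset_set (L \<union> X) = mset_set L + mset_set X" "mset_set (H \<union> L) = mset_set H + mset_set L"
      by (simp_all add: mset_set_Union high.hyps(1,3,11))
  qed
  have 2: "mset_set H = add_mset (Min H) (mset_set (H - {Min H}))"
    using high.hyps by (intro mset_set.remove) auto
  have 3: "content Bs = mset_set X + content T + mset (leads Bs)"
    using high.IH high.hyps(7) by simp
  show ?case
    unfolding high.hyps(12,13) by (simp add: high.hyps(4) 1 2 3 add_ac)
qed


subsection \<open>Minimaj order\<close>

text \<open>If some letter is at most \<open>c\<close>, then \<open>r\<close> is the largest such
  letter, and the rotation carries exactly the letters up to \<open>c\<close> behind the others; if
  there is none, the block stays increasing.\<close>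

lemma minimaj_order_Cons:
  assumes "Bs \<noteq> []" "finite B"
  defines "c \<equiv> hd (hd (minimaj_order Bs))"
  shows "minimaj_order (B # Bs) =
    (sorted_list_of_set {x \<in> B. c < x} @ sorted_list_of_set {x \<in> B. x \<le> c}) # minimaj_order Bs"
proof -
  define H L where "H = {x \<in> B. c < x}" and "L = {x \<in> B. x \<le> c}"
  have fin: "finite H" "finite L" using assms by (auto simp: H_def L_def)
  have B: "B = L \<union> H" by (auto simp: H_def L_def)
  obtain C Bs' where Bs: "Bs = C # Bs'" using assms(1) by (cases Bs) auto
  have sl: "sorted_list_of_set B = sorted_list_of_set L @ sorted_list_of_set H"
    unfolding B by (rule sorted_list_of_set_append[OF fin(2,1)]) (auto simp: H_def L_def)
  have "{x \<in> B. x \<le> Max L} = L" if "L \<noteq> {}"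
  proof -
    have "Max L \<le> c" using Max_in[OF fin(2) that] by (simp add: L_def)
    then show ?thesis using Max_ge[OF fin(2)] by (auto simp: L_def)
  qed
  then have "(if L = {} then sorted_list_of_set B
      else rotate (card {x \<in> B. x \<le> Max L}) (sorted_list_of_set B))
    = sorted_list_of_set H @ sorted_list_of_set L"
    using rotate_append[of "sorted_list_of_set L" "sorted_list_of_set H"] by (simp add: sl)
  moreover have "minimaj_order (B # Bs) = (if L = {} then sorted_list_of_set B
      else rotate (card {x \<in> B. x \<le> Max L}) (sorted_list_of_set B)) # minimaj_order Bs"
    unfolding Bs L_def c_def by (simp only: minimaj_order.simps Let_def)
  ultimately show ?thesis
    unfolding H_def L_def by (simp only:)
qed

lemma sorted_list_of_set_Min:
  "finite A \<Longrightarrow> A \<noteq> {} \<Longrightarrow> sorted_list_of_set A = Min A # sorted_list_of_set (A - {Min A})"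
  using sorted_list_of_set_nonempty by blast

lemma minimaj_order_low:
  assumes "Bs \<noteq> []" "finite B" "\<forall>x \<in> B. x \<le> hd (hd (minimaj_order Bs))"
  shows "minimaj_order (B # Bs) = sorted_list_of_set B # minimaj_order Bs"
proof -
  have "{x \<in> B. hd (hd (minimaj_order Bs)) < x} = {}" "{x \<in> B. x \<le> hd (hd (minimaj_order Bs))} = B"
    using assms(3) by fastforce+
  then show ?thesis
    unfolding minimaj_order_Cons[OF assms(1,2)] by (simp only: sorted_list_of_set_empty append_Nil)
qed

lemma minimaj_order_high:
  assumes "Bs \<noteq> []" "finite H" "finite L"
    "\<forall>x \<in> H. hd (hd (minimaj_order Bs)) < x" "\<forall>x \<in> L. x \<le> hd (hd (minimaj_order Bs))"
  shows "minimaj_order ((H \<union> L) # Bs)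
    = (sorted_list_of_set H @ sorted_list_of_set L) # minimaj_order Bs"
proof -
  have "{x \<in> H \<union> L. hd (hd (minimaj_order Bs)) < x} = H" "{x \<in> H \<union> L. x \<le> hd (hd (minimaj_order Bs))} = L"
    using assms(4,5) by fastforce+
  moreover have "finite (H \<union> L)" using assms(2,3) by simp
  ultimately show ?thesis
    unfolding minimaj_order_Cons[OF assms(1) \<open>finite (H \<union> L)\<close>] by (simp only:)
qed

lemma map_hd_minimaj_order: "ordered_blocks \<pi> \<Longrightarrow> map hd (minimaj_order \<pi>) = leads \<pi>"
proof (induction \<pi> rule: ordered_blocks_induct)
  case (single B)
  then show ?case by (simp add: sorted_list_of_set_Min)
next
  case (low B Bs c X T)
  have c: "hd (hd (minimaj_order Bs)) = c"
    using low ordered_blocks_ne[of Bs] by (metis hd_map leads_ne list.map_disc_iff)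
  show ?case
    using low ordered_blocks_ne[of Bs] by (simp add: minimaj_order_low c sorted_list_of_set_Min[of B])
next
  case (high B Bs c X T H L)
  have c: "hd (hd (minimaj_order Bs)) = c"
    using high ordered_blocks_ne[of Bs] by (metis hd_map leads_ne list.map_disc_iff)
  show ?case
    using high ordered_blocks_ne[of Bs] by (simp add: minimaj_order_high c sorted_list_of_set_Min[of H])
qed

lemma hd_hd_minimaj_order: "ordered_blocks \<pi> \<Longrightarrow> hd (hd (minimaj_order \<pi>)) = hd (leads \<pi>)"
  by (metis hd_map leads_ne list.map_disc_iff map_hd_minimaj_order ordered_blocks_ne)

lemma length_minimaj_order: "ordered_blocks \<pi> \<Longrightarrow> length (minimaj_order \<pi>) = length \<pi>"
  by (metis length_leads length_map map_hd_minimaj_order)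

lemma Nil_notin_minimaj_order: "ordered_blocks \<pi> \<Longrightarrow> [] \<notin> set (minimaj_order \<pi>)"
proof (induction \<pi> rule: ordered_blocks_induct)
  case (single B)
  then show ?case by (simp add: sorted_list_of_set_Min)
next
  case (low B Bs c X T)
  then show ?case
    by (simp add: minimaj_order_low hd_hd_minimaj_order ordered_blocks_ne sorted_list_of_set_Min[of B])
next
  case (high B Bs c X T H L)
  then show ?case
    by (simp add: minimaj_order_high hd_hd_minimaj_order ordered_blocks_ne sorted_list_of_set_Min[of H])
qed

lemma hd_concat_minimaj_order:
  "ordered_blocks \<pi> \<Longrightarrow> concat (minimaj_order \<pi>) \<noteq> [] \<and> hd (concat (minimaj_order \<pi>)) = hd (leads \<pi>)"
  using Nil_notin_minimaj_order[of \<pi>] hd_hd_minimaj_order[of \<pi>] length_minimaj_order[of \<pi>]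
    ordered_blocks_ne[of \<pi>]
  by (cases "minimaj_order \<pi>") auto

lemma descents_minimaj_low:
  assumes "finite B" "ordered_blocks Bs" "\<forall>x \<in> B. x \<le> hd (leads Bs)"
  shows "descents (sorted_list_of_set B @ concat (minimaj_order Bs))
    = (+) (card B) ` descents (concat (minimaj_order Bs))"
proof -
  have "\<not> hd (leads Bs) < last (sorted_list_of_set B)" if "sorted_list_of_set B \<noteq> []"
    using assms last_in_set[OF that] by (auto simp: not_less)
  then show ?thesis
    using hd_concat_minimaj_order[OF assms(2)] assms(1)
    by (cases "sorted_list_of_set B = []") (simp_all add: descents_append descents_sorted)
qed

text \<open>The letter following \<open>H\<close> is at most \<open>c\<close>, lying in
  \<open>L\<close> or being \<open>c\<close> itself, so a descent ends \<open>H\<close>; none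
  follows \<open>L\<close>, whose letters do not exceed \<open>c\<close>.\<close>

lemma descents_minimaj_high:
  assumes "finite H" "H \<noteq> {}" "finite L" "ordered_blocks Bs"
    "\<forall>x \<in> H. hd (leads Bs) < x" "\<forall>x \<in> L. x \<le> hd (leads Bs)"
  shows "descents ((sorted_list_of_set H @ sorted_list_of_set L) @ concat (minimaj_order Bs))
    = insert (card H) ((+) (card H + card L) ` descents (concat (minimaj_order Bs)))"
proof -
  let ?u = "sorted_list_of_set L @ concat (minimaj_order Bs)"
  have ne: "sorted_list_of_set H \<noteq> []" using assms by simp
  have "last (sorted_list_of_set H) > hd (leads Bs)"
    using last_in_set[OF ne] assms by auto
  moreover have "hd ?u \<le> hd (leads Bs)" "?u \<noteq> []"
    using hd_concat_minimaj_order[OF assms(4)] assms hd_in_set[of "sorted_list_of_set L"]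
    by (cases "sorted_list_of_set L = []"; auto)+
  ultimately show ?thesis
    using descents_minimaj_low[OF assms(3,4,6)] ne
    by (simp add: descents_append[of "sorted_list_of_set H"] descents_sorted image_image add.assoc)
qed

lemma descents_leads:
  assumes "ordered_blocks Bs"
  shows "b \<le> hd (leads Bs) \<Longrightarrow> descents (b # leads Bs) = Suc ` descents (leads Bs)"
    and "hd (leads Bs) < b \<Longrightarrow> descents (b # leads Bs) = insert 1 (Suc ` descents (leads Bs))"
  using ordered_blocks_ne[OF assms] by (auto simp: descents_Cons)

lemma descents_pos: "j \<in> descents w \<Longrightarrow> 1 \<le> j"
  by (simp add: descents_def)

lemma notin_shifted_descents: "(a::nat) \<le> b \<Longrightarrow> a \<notin> (+) b ` descents w"
  using descents_pos by fastforce

lemma card_descents_minimaj: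
  "ordered_blocks \<pi> \<Longrightarrow> card (descents (concat (minimaj_order \<pi>))) = card (descents (leads \<pi>)) \<and>
     length (col_sets \<pi>) = Suc (card (descents (leads \<pi>)))"
proof (induction \<pi> rule: ordered_blocks_induct)
  case (single B)
  then show ?case by (simp add: descents_sorted)
next
  case (low B Bs c X T)
  then show ?case
    using Min_low_le[of B c]
    by (simp add: minimaj_order_low hd_hd_minimaj_order ordered_blocks_ne descents_minimaj_low descents_leads card_image)
next
  case (high B Bs c X T H L)
  have "descents (concat (minimaj_order (B # Bs)))
    = insert (card H) ((+) (card H + card L) ` descents (concat (minimaj_order Bs)))"
    using high descents_minimaj_high[of H L Bs] by (simp add: minimaj_order_high hd_hd_minimaj_order ordered_blocks_ne)
  moreover have "card H \<notin> (+) (card H + card L) ` descents (concat (minimaj_order Bs))"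
    by (rule notin_shifted_descents) simp
  ultimately show ?case
    using high Min_high_greater[of H c] Suc_notin_descents[of "leads Bs"]
    by (simp add: descents_leads card_image)
qed

text \<open>Two readings: for \<open>col_sets \<pi>\<close> each letter counts once for every
  descent of the minimaj word not before it; for the columns of \<open>col_words\<close> it counts
  once for every bar separating columns to its left.\<close>

fun weighted_size :: "nat set list \<Rightarrow> nat" where
  "weighted_size [] = 0"
| "weighted_size (C # Cs) = card C * length Cs + weighted_size Cs"

lemma sum_shift: "(\<Sum>j\<in>(+) a ` D. j) = a * card D + \<Sum>D" for a :: nat
  by (simp add: sum.reindex sum.distrib)

text \<open>The count behind the formula: a descent position is the number of letters up to it. The
  leading letters among them are as many as the number of the block of the descent, which is a
  descent of \<open>leads \<pi>\<close>; the other letters give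
  \<open>weighted_size\<close>.\<close>

lemma minimaj_eq:
  "ordered_blocks \<pi> \<Longrightarrow> minimaj \<pi> = \<Sum>(descents (leads \<pi>)) + weighted_size (col_sets \<pi>)"
proof (induction \<pi> rule: ordered_blocks_induct)
  case (single B)
  then show ?case by (simp add: minimaj_def descents_sorted)
next
  case (low B Bs c X T)
  let ?l = "card (descents (leads Bs))"
  note cd = card_descents_minimaj[OF low(3)]
  have "minimaj (B # Bs) = card B * ?l + minimaj Bs"
    using low cd
    by (simp add: minimaj_def minimaj_order_low hd_hd_minimaj_order ordered_blocks_ne
        descents_minimaj_low sum_shift)
  moreover have "\<Sum>(descents (leads (B # Bs))) = ?l + \<Sum>(descents (leads Bs))"
    using low Min_low_le[of B c] sum_shift[of 1 "descents (leads Bs)"] by (simp add: descents_leads)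
  moreover have "weighted_size (col_sets (B # Bs)) = (card B - 1) * ?l + weighted_size (col_sets Bs)"
  proof -
    have "card ((B - {Min B}) \<union> X) = card (B - {Min B}) + card X"
      by (rule card_Un_disjoint) (use low.hyps(1,6,7,8) in fastforce)+
    then show ?thesis using low cd by (simp add: algebra_simps)
  qed
  moreover obtain h where "card B = Suc h" using low by (metis card_gt_0_iff gr0_implies_Suc)
  ultimately show ?case
    using low.IH by (simp add: algebra_simps)
next
  case (high B Bs c X T H L)
  let ?l = "card (descents (leads Bs))"
  note cd = card_descents_minimaj[OF high(5)]
  have "descents (concat (minimaj_order (B # Bs)))
    = insert (card H) ((+) (card H + card L) ` descents (concat (minimaj_order Bs)))"
    using high descents_minimaj_high[of H L Bs] by (simp add: minimaj_order_high hd_hd_minimaj_order ordered_blocks_ne)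
  moreover have "card H \<notin> (+) (card H + card L) ` descents (concat (minimaj_order Bs))"
    by (rule notin_shifted_descents) simp
  ultimately have "minimaj (B # Bs) = card H + (card H + card L) * ?l + minimaj Bs"
    using cd by (simp add: minimaj_def sum_shift)
  moreover have "\<Sum>(descents (leads (B # Bs))) = 1 + ?l + \<Sum>(descents (leads Bs))"
    using high Min_high_greater[of H c] sum_shift[of 1 "descents (leads Bs)"]
      Suc_notin_descents[of "leads Bs"]
    by (simp add: descents_leads)
  moreover have "weighted_size (col_sets (B # Bs))
      = (card H - 1) * Suc ?l + card L * ?l + weighted_size (col_sets Bs)"
  proof -
    have "card (L \<union> X) = card L + card X"
      by (rule card_Un_disjoint) (use high.hyps(3,9,10,11) in fastforce)+
    then show ?thesis using high cd by (simp add: algebra_simps)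
  qed
  moreover obtain h where "card H = Suc h" using high by (metis card_gt_0_iff gr0_implies_Suc)
  ultimately show ?case
    using high.IH by (simp add: algebra_simps)
qed


subsection \<open>The map \<open>\<phi>\<close> and its reading\<close>

text \<open>Common form of the rows of the ribbon and the columns: \<open>f\<close> is applied to
  pairs of consecutive cuts, given by \<open>eta\<close> for the rows and by \<open>delta\<close>
  for the columns.\<close>

fun segments :: "(nat \<Rightarrow> nat \<Rightarrow> 'a) \<Rightarrow> nat \<Rightarrow> nat list \<Rightarrow> 'a list" where
  "segments f a [] = []"
| "segments f a (d # ds) = f a d # segments f d ds"

lemma length_segments [simp]: "length (segments f a ds) = length ds"
  by (induction f a ds rule: segments.induct) auto

lemma nth_segments: "i < length ds \<Longrightarrow> segments f a ds ! i = f ((a # ds) ! i) (ds ! i)"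
  by (induction f a ds arbitrary: i rule: segments.induct) (auto simp: nth_Cons split: nat.splits)

lemma segments_shift:
  "segments f (c + a) (map ((+) c) ds) = segments (\<lambda>a d. f (c + a) (c + d)) a ds"
  by (induction ds arbitrary: a) auto

definition cuts :: "nat list \<Rightarrow> nat list" where
  "cuts w = sorted_list_of_set (descents w) @ [length w]"

lemma length_cuts: "length (cuts w) = Suc (card (descents w))"
  by (simp add: cuts_def)

lemma cuts_le: "d \<in> set (cuts w) \<Longrightarrow> d \<le> length w"
  using descents_subset[of w] by (auto simp: cuts_def)

lemma sorted_list_of_set_shift:
  fixes c :: nat
  assumes "finite A"
  shows "sorted_list_of_set ((+) c ` A) = map ((+) c) (sorted_list_of_set A)"
proof (rule sorted_distinct_set_unique)
  show "sorted (map ((+) c) (sorted_list_of_set A))"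
    unfolding sorted_map by (rule sorted_wrt_mono_rel[of _ "(\<le>)"]) auto
qed (use assms in \<open>auto simp: distinct_map\<close>)

lemma sorted_list_of_set_insert_shift:
  fixes c :: nat
  assumes "finite D" "x \<le> c" "\<And>j. j \<in> D \<Longrightarrow> 1 \<le> j"
  shows "sorted_list_of_set (insert x ((+) c ` D)) = x # map ((+) c) (sorted_list_of_set D)"
  using sorted_list_of_set_append[of "{x}" "(+) c ` D"] assms sorted_list_of_set_shift[OF assms(1)]
  by fastforce

lemma segments_cuts_runs:
  "xs \<noteq> [] \<Longrightarrow> segments (\<lambda>a d. map (\<lambda>i. xs ! (i - 1)) [a + 1..<d + 1]) 0 (cuts xs) = runs (\<le>) xs"
proof (induction xs rule: list_nonempty_induct)
  case (single x)
  then show ?case by (simp add: cuts_def descents_sorted)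
next
  case (cons x xs)
  define F where "F = (\<lambda>(ys :: nat list) a d. map (\<lambda>i. ys ! (i - 1)) [a + 1..<d + 1])"
  have shift: "F (x # xs) (1 + a) (1 + d) = F xs a d" for a d
  proof -
    have "[1 + a + 1..<1 + d + 1] = map Suc [a + 1..<d + 1]"
      by (simp only: map_Suc_upt add_Suc_right plus_1_eq_Suc Suc_eq_plus1[symmetric])
    then show ?thesis by (auto simp: F_def comp_def nth_Cons' simp del: upt_Suc)
  qed
  \<comment> \<open>The first segment starts at 0 in both words, so if no descent follows
    \<open>x\<close> it absorbs \<open>x\<close>, while all later segments are merely
    shifted.\<close>
  have first: "F (x # xs) 0 (1 + d) = x # F xs 0 d" for d
  proof -
    have "[0 + 1..<1 + d + 1] = 1 # map Suc [0 + 1..<d + 1]"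
      by (simp add: map_Suc_upt upt_conv_Cons del: upt_Suc)
    then show ?thesis by (auto simp: F_def comp_def nth_Cons' simp del: upt_Suc)
  qed
  obtain d ds where ds: "cuts xs = d # ds" by (cases "cuts xs") (auto simp: cuts_def)
  have IH: "segments (F xs) 0 (cuts xs) = runs (\<le>) xs"
    unfolding F_def by (rule cons(2))
  have tl: "segments (F (x # xs)) (1 + a) (map ((+) 1) es) = segments (F xs) a es" for a es
    unfolding segments_shift shift ..
  have "segments (F (x # xs)) 0 (cuts (x # xs)) = runs (\<le>) (x # xs)"
  proof (cases "hd xs < x")
    case True
    have "cuts (x # xs) = 1 # map ((+) 1) (cuts xs)"
      using True cons(1) sorted_list_of_set_insert_shift[of "descents xs" 1 1] descents_pos[of _ xs]
      by (simp add: cuts_def descents_Cons)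
    then have "segments (F (x # xs)) 0 (cuts (x # xs)) = F (x # xs) 0 (1 + 0) # segments (F xs) 0 (cuts xs)"
      using tl[of 0 "cuts xs"] by simp
    also have "\<dots> = [x] # runs (\<le>) xs"
      unfolding first IH by (simp add: F_def)
    finally show ?thesis using True cons(1) by (simp add: runs_Cons)
  next
    case False
    have "cuts (x # xs) = map ((+) 1) (cuts xs)"
      using False cons(1) sorted_list_of_set_shift[of "descents xs" 1]
      by (simp add: cuts_def descents_Cons)
    then have "segments (F (x # xs)) 0 (cuts (x # xs)) = (x # F xs 0 d) # segments (F xs) d ds"
      using tl[of d ds] first[of d] by (simp add: ds)
    then show ?thesis using False cons(1) IH ds by (simp add: runs_Cons flip: IH)
  qed
  then show ?case unfolding F_def .
qed

section \<open>Non-leading letters between consecutive descents\<close>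

text \<open>An unsorted \<open>nonleading\<close> with its end positions as arguments, so that it
  can be translated along the word.\<close>

definition nonlead :: "nat list list \<Rightarrow> nat \<Rightarrow> nat \<Rightarrow> nat list" where
  "nonlead ws a d = map (\<lambda>j. concat ws ! (j - 1)) (filter (\<lambda>j. j \<notin> leading ws) [a + 1..<d + 1])"

lemma leading_eq: "leading ws = (\<lambda>i. block_end ws i + 1) ` {..<length ws}"
proof -
  have "block_end ws i + 1 \<in> leading ws" if "i < length ws" for i
    using that unfolding leading_def by (intro CollectI exI[of _ "Suc i"]) simp
  moreover have "\<exists>i<length ws. j = block_end ws i + 1" if j: "j \<in> leading ws" for j
  proof -
    obtain i where "j = block_end ws (i - 1) + 1" "1 \<le> i" "i \<le> length ws"
      using j unfolding leading_def by blast
    then show ?thesis by (intro exI[of _ "i - 1"]) auto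
  qed
  ultimately show ?thesis by blast
qed

lemma block_end_Cons: "block_end (v # ws) (Suc q) = length v + block_end ws q"
  by (simp add: block_end_def)

lemma leading_Cons: "leading (v # ws) = insert 1 ((+) (length v) ` leading ws)"
  by (simp add: leading_eq lessThan_Suc_eq_insert_0 image_image block_end_Cons)

lemma leading_pos: "j \<in> leading ws \<Longrightarrow> 1 \<le> j"
  by (auto simp: leading_eq)

lemma nonlead_append: "a \<le> b \<Longrightarrow> b \<le> c \<Longrightarrow> nonlead ws a c = nonlead ws a b @ nonlead ws b c"
  using upt_add_eq_append[of "a + 1" "b + 1" "c - b"] by (simp add: nonlead_def del: upt_Suc)

lemma nonlead_shift:
  assumes "v \<noteq> []"
  shows "nonlead (v # ws) (length v + a) (length v + d) = nonlead ws a d"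
proof -
  have "[length v + a + 1..<length v + d + 1] = map ((+) (length v)) [a + 1..<d + 1]"
    by (rule nth_equalityI) (auto simp del: upt_Suc)
  moreover have "length v + j \<in> leading (v # ws) \<longleftrightarrow> j \<in> leading ws" if "1 \<le> j" for j
    using that assms by (cases v) (auto simp: leading_Cons)
  then have "filter (\<lambda>j. length v + j \<notin> leading (v # ws)) [a + 1..<d + 1]
      = filter (\<lambda>j. j \<notin> leading ws) [a + 1..<d + 1]"
    by (intro filter_cong) auto
  ultimately show ?thesis
    by (auto simp: nonlead_def filter_map comp_def nth_append simp del: upt_Suc)
qed

lemma nonlead_first_block:
  assumes "1 \<le> a" "a \<le> d" "d \<le> length v"
  shows "nonlead (v # ws) a d = take (d - a) (drop a v)"
proof -
  have "j \<notin> leading (v # ws)" if "j \<in> set [a + 1..<d + 1]" for j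
    using that assms leading_pos[of _ ws] by (fastforce simp: leading_Cons)
  then have "filter (\<lambda>j. j \<notin> leading (v # ws)) [a + 1..<d + 1] = [a + 1..<d + 1]"
    by (simp add: filter_id_conv del: upt_Suc)
  then have "nonlead (v # ws) a d = map (\<lambda>j. (v @ concat ws) ! (j - 1)) [a + 1..<d + 1]"
    by (simp add: nonlead_def del: upt_Suc)
  also have "\<dots> = take (d - a) (drop a v)"
    by (rule nth_equalityI) (use assms in \<open>auto simp: nth_append simp del: upt_Suc\<close>)
  finally show ?thesis .
qed

lemma nonlead_0:
  assumes "1 \<le> d" "d \<le> length v"
  shows "nonlead (v # ws) 0 d = tl (take d v)"
proof -
  have "nonlead (v # ws) 0 1 = []" by (simp add: nonlead_def leading_Cons)
  then show ?thesis
    using assms nonlead_append[of 0 1 d "v # ws"] nonlead_first_block[of 1 d v ws]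
    by (simp add: tl_take drop_Suc)
qed

lemma cuts_minimaj_low:
  assumes "finite B" "ordered_blocks Bs" "\<forall>x \<in> B. x \<le> hd (leads Bs)"
  shows "cuts (sorted_list_of_set B @ concat (minimaj_order Bs))
    = map ((+) (card B)) (cuts (concat (minimaj_order Bs)))"
  by (simp add: cuts_def descents_minimaj_low[OF assms] sorted_list_of_set_shift)

lemma cuts_minimaj_high:
  assumes "finite H" "H \<noteq> {}" "finite L" "ordered_blocks Bs"
    "\<forall>x \<in> H. hd (leads Bs) < x" "\<forall>x \<in> L. x \<le> hd (leads Bs)"
  shows "cuts ((sorted_list_of_set H @ sorted_list_of_set L) @ concat (minimaj_order Bs))
    = card H # map ((+) (card H + card L)) (cuts (concat (minimaj_order Bs)))"
  unfolding cuts_def descents_minimaj_high[OF assms]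
  by (subst sorted_list_of_set_insert_shift) (auto simp: descents_def)

text \<open>Distinctness makes sorting a segment the same as listing its set, as
  \<open>phi_eq\<close> requires. It holds because the letters merged from a new block lie up to
  \<open>c\<close> and the others above.\<close>

lemma segments_cuts_col_sets:
  assumes "ordered_blocks \<pi>"
  defines "S \<equiv> segments (nonlead (minimaj_order \<pi>)) 0 (cuts (concat (minimaj_order \<pi>)))"
  shows "map set S = col_sets \<pi> \<and> (\<forall>x \<in> set S. distinct x)"
  using assms(1) unfolding S_def
proof (induction \<pi> rule: ordered_blocks_induct)
  case (single B)
  have "card B \<ge> 1" using single by (simp add: Suc_le_eq card_gt_0_iff)
  then show ?case
    using single by (simp add: cuts_def descents_sorted nonlead_0 sorted_list_of_set_Min[of B])
next
  case (low B Bs c X T)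
  let ?ws = "minimaj_order Bs" and ?v = "sorted_list_of_set B"
  have mo: "minimaj_order (B # Bs) = ?v # ?ws"
    using low.hyps by (intro minimaj_order_low) (auto simp: hd_hd_minimaj_order ordered_blocks_ne)
  obtain d ds where ds: "cuts (concat ?ws) = d # ds"
    by (cases "cuts (concat ?ws)") (auto simp: cuts_def)
  have v: "?v \<noteq> []" "1 \<le> card B" using low.hyps(1,2) by (simp_all add: Suc_le_eq card_gt_0_iff)
  note shift = nonlead_shift[OF v(1), unfolded sorted_list_of_set.length_sorted_key_list_of_set]
  have 1: "nonlead (?v # ?ws) 0 (card B + d) = tl ?v @ nonlead ?ws 0 d"
    using nonlead_append[of 0 "card B" "card B + d" "?v # ?ws"] nonlead_0[of "card B" ?v ?ws]
      shift[of ?ws 0 d] v(2) by simp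
  have "cuts (concat (?v # ?ws)) = map ((+) (card B)) (d # ds)"
    using cuts_minimaj_low[of B Bs] low.hyps(1,3,4,6) ds by simp
  then have S: "segments (nonlead (?v # ?ws)) 0 (cuts (concat (?v # ?ws)))
      = (tl ?v @ nonlead ?ws 0 d) # segments (nonlead ?ws) d ds"
    using segments_shift[of "nonlead (?v # ?ws)" "card B" d ds] 1 by (simp add: shift)
  have IH: "set (nonlead ?ws 0 d) = X" "map set (segments (nonlead ?ws) d ds) = T"
    "distinct (nonlead ?ws 0 d)" "\<forall>x \<in> set (segments (nonlead ?ws) d ds). distinct x"
    using low.IH low.hyps(5) ds by auto
  have tl: "tl ?v = sorted_list_of_set (B - {Min B})"
    using low.hyps(1,2) by (simp add: sorted_list_of_set_Min[of B])
  have "(B - {Min B}) \<inter> X = {}" using low.hyps(6,7) by fastforce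
  then show ?case
    unfolding mo S using IH low.hyps(1) by (simp add: tl low.hyps(10))
next
  case (high B Bs c X T H L)
  let ?ws = "minimaj_order Bs" and ?v = "sorted_list_of_set H @ sorted_list_of_set L"
  have mo: "minimaj_order (B # Bs) = ?v # ?ws"
    unfolding high.hyps(4) using high.hyps(1,3,5,6,8,9)
    by (intro minimaj_order_high) (auto simp: hd_hd_minimaj_order ordered_blocks_ne)
  obtain d ds where ds: "cuts (concat ?ws) = d # ds"
    by (cases "cuts (concat ?ws)") (auto simp: cuts_def)
  have v: "?v \<noteq> []" "1 \<le> card H" using high.hyps(1,2) by (simp_all add: Suc_le_eq card_gt_0_iff)
  have len: "length ?v = card H + card L" by simp
  note shift = nonlead_shift[OF v(1), unfolded len]
  have 1: "nonlead (?v # ?ws) (card H) (card H + card L + d) = sorted_list_of_set L @ nonlead ?ws 0 d"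
    using nonlead_append[of "card H" "card H + card L" "card H + card L + d" "?v # ?ws"]
      nonlead_first_block[of "card H" "card H + card L" ?v ?ws] shift[of ?ws 0 d] v(2) by simp
  have 2: "nonlead (?v # ?ws) 0 (card H) = tl (sorted_list_of_set H)"
    using nonlead_0[of "card H" ?v ?ws] v(2) by simp
  have "cuts (concat (?v # ?ws)) = card H # map ((+) (card H + card L)) (d # ds)"
    using cuts_minimaj_high[of H L Bs] high.hyps(1,2,3,5,6,8,9) ds by simp
  then have S: "segments (nonlead (?v # ?ws)) 0 (cuts (concat (?v # ?ws)))
      = tl (sorted_list_of_set H) # (sorted_list_of_set L @ nonlead ?ws 0 d) # segments (nonlead ?ws) d ds"
    using segments_shift[of "nonlead (?v # ?ws)" "card H + card L" d ds] 1 2 by (simp add: shift)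
  have IH: "set (nonlead ?ws 0 d) = X" "map set (segments (nonlead ?ws) d ds) = T"
    "distinct (nonlead ?ws 0 d)" "\<forall>x \<in> set (segments (nonlead ?ws) d ds). distinct x"
    using high.IH high.hyps(7) ds by auto
  have tl: "tl (sorted_list_of_set H) = sorted_list_of_set (H - {Min H})"
    using high.hyps(1,2) by (simp add: sorted_list_of_set_Min[of H])
  have "L \<inter> X = {}" using high.hyps(9,10) by fastforce
  then show ?case
    unfolding mo S using IH high.hyps(1,3) by (simp add: tl high.hyps(13))
qed

lemma block_of_Cons:
  assumes "1 \<le> j" "j \<le> length v + length (concat ws)"
  shows "block_of (v # ws) j = (if j \<le> length v then 1 else Suc (block_of ws (j - length v)))"
proof -
  define i where "i = (if j \<le> length v then 1 else Suc (block_of ws (j - length v)))"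
  have "block_of (v # ws) j \<le> q \<longleftrightarrow> i \<le> q" for q
  proof (cases q)
    case 0
    then show ?thesis using block_of_le_iff[of j "v # ws" 0] assms by (simp add: i_def)
  next
    case (Suc r)
    then show ?thesis
      using block_of_le_iff[of j "v # ws" q] block_of_le_iff[of "j - length v" ws r] assms
      by (auto simp: block_end_Cons i_def)
  qed
  from this[of "block_of (v # ws) j"] this[of i] show ?thesis by (simp add: i_def)
qed

lemma block_of_image_shift:
  assumes "D \<subseteq> {1..length (concat ws)}"
  shows "block_of (v # ws) ` (+) (length v) ` D = Suc ` block_of ws ` D"
proof -
  have "block_of (v # ws) (length v + j) = Suc (block_of ws j)" if "j \<in> D" for j
    using that assms block_of_Cons[of "length v + j" v ws] by force
  then show ?thesis by (simp add: image_image)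
qed

text \<open>A block contains a descent exactly when some letter exceeds the next leading letter.
  Such letters come first in the block, so this means that its own leading letter is the larger
  one.\<close>

lemma block_of_descents:
  "ordered_blocks \<pi> \<Longrightarrow>
     block_of (minimaj_order \<pi>) ` descents (concat (minimaj_order \<pi>)) = descents (leads \<pi>)"
proof (induction \<pi> rule: ordered_blocks_induct)
  case (single B)
  then show ?case by (simp add: descents_sorted)
next
  case (low B Bs c X T)
  let ?ws = "minimaj_order Bs" and ?v = "sorted_list_of_set B"
  have mo: "minimaj_order (B # Bs) = ?v # ?ws"
    using low.hyps by (intro minimaj_order_low) (auto simp: hd_hd_minimaj_order ordered_blocks_ne)
  have "descents (concat ?ws) \<subseteq> {1..length (concat ?ws)}"
    using descents_subset[of "concat ?ws"] by force
  from block_of_image_shift[OF this, of ?v]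
  have "block_of (?v # ?ws) ` descents (concat (?v # ?ws)) = Suc ` descents (leads Bs)"
    using descents_minimaj_low[of B Bs] low.hyps(1,3,4,6) low.IH by simp
  moreover have "Min B \<le> c" using low.hyps by (intro Min_low_le)
  ultimately show ?case
    unfolding mo low.hyps(9) using descents_leads(1)[OF low.hyps(3)] low.hyps(4) by simp
next
  case (high B Bs c X T H L)
  let ?ws = "minimaj_order Bs" and ?v = "sorted_list_of_set H @ sorted_list_of_set L"
  have mo: "minimaj_order (B # Bs) = ?v # ?ws"
    unfolding high.hyps(4) using high.hyps(1,3,5,6,8,9)
    by (intro minimaj_order_high) (auto simp: hd_hd_minimaj_order ordered_blocks_ne)
  have "descents (concat ?ws) \<subseteq> {1..length (concat ?ws)}"
    using descents_subset[of "concat ?ws"] by force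
  note sh = block_of_image_shift[OF this, of ?v]
  have "1 \<le> card H" using high.hyps(1,2) by (simp add: Suc_le_eq card_gt_0_iff)
  then have "block_of (?v # ?ws) (card H) = 1"
    using block_of_Cons[of "card H" ?v ?ws] by simp
  then have "block_of (?v # ?ws) ` descents (concat (?v # ?ws)) = insert 1 (Suc ` descents (leads Bs))"
    using descents_minimaj_high[of H L Bs] high.hyps(1,2,3,5,6,8,9) high.IH sh by simp
  moreover have "c < Min H" using high.hyps(1,2,8) by (intro Min_high_greater)
  ultimately show ?case
    unfolding mo high.hyps(12) using descents_leads(2)[OF high.hyps(5)] high.hyps(6) by simp
qed

lemma phi_eq:
  assumes "ordered_blocks \<pi>"
  shows "phi \<pi> = (map sorted_list_of_set (rev (tl (col_sets \<pi>))),
    map (\<lambda>x. [x]) (rev (sorted_list_of_set (hd (col_sets \<pi>)))) @ runs (\<le>) (leads \<pi>))"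
proof -
  define ws Cs l where "ws = minimaj_order \<pi>" and "Cs = col_sets \<pi>"
    and "l = card (descents (concat ws))"
  have l: "l = card (descents (leads \<pi>))" "length Cs = Suc l"
    using card_descents_minimaj[OF assms] by (simp_all add: l_def ws_def Cs_def)
  note seg = segments_cuts_col_sets[OF assms, folded ws_def Cs_def]
  have nl: "nonleading ws s = sorted_list_of_set (Cs ! (s - 1))" if s: "1 \<le> s" "s \<le> l + 1" for s
  proof -
    have i: "s - 1 < length (cuts (concat ws))" using s by (simp add: length_cuts l_def)
    define x where "x = segments (nonlead ws) 0 (cuts (concat ws)) ! (s - 1)"
    have "x \<in> set (segments (nonlead ws) 0 (cuts (concat ws)))"
      unfolding x_def by (rule nth_mem) (use i in simp)
    then have "distinct x" using seg by blast
    moreover have "set x = Cs ! (s - 1)"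
      using seg i unfolding x_def by (metis length_segments nth_map)
    ultimately have "sort x = sorted_list_of_set (Cs ! (s - 1))"
      by (metis distinct_remdups_id sorted_list_of_set_sort_remdups)
    moreover have "nonleading ws s = sort x"
    proof -
      have "delta ws (s - 1) = (0 # cuts (concat ws)) ! (s - 1)" "delta ws s = cuts (concat ws) ! (s - 1)"
        using s by (simp_all add: delta_def cuts_def nth_Cons')
      then show ?thesis
        unfolding nonleading_def x_def nth_segments[OF i] nonlead_def by simp
    qed
    ultimately show ?thesis by simp
  qed
  \<comment> \<open>Column \<open>j\<close> is segment number \<open>l - j + 2\<close>, which has
    list index \<open>l - j + 1\<close> in \<open>Cs\<close>; hence the reversed tail.\<close>
  have cols: "map (\<lambda>j. nonleading ws (l - j + 2)) [1..<l + 1] = map sorted_list_of_set (rev (tl Cs))"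
  proof (rule nth_equalityI)
    fix i assume "i < length (map (\<lambda>j. nonleading ws (l - j + 2)) [1..<l + 1])"
    then have i: "i < l" by (simp del: upt_Suc)
    have "nonleading ws (l - (1 + i) + 2) = sorted_list_of_set (Cs ! (l - i))"
      using nl[of "l - (1 + i) + 2"] i by (simp add: Suc_diff_Suc)
    moreover have "rev (tl Cs) ! i = Cs ! (l - i)"
      using i l(2) by (simp add: rev_nth nth_tl Suc_diff_Suc)
    ultimately show "map (\<lambda>j. nonleading ws (l - j + 2)) [1..<l + 1] ! i
        = map sorted_list_of_set (rev (tl Cs)) ! i"
      using i l(2) by (simp del: upt_Suc)
  qed (use l in \<open>simp del: upt_Suc\<close>)
  have first: "nonleading ws 1 = sorted_list_of_set (hd Cs)"
    using nl[of 1] l(2) by (cases Cs) auto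
  have hd_ws: "map hd ws = leads \<pi>" using map_hd_minimaj_order[OF assms] by (simp add: ws_def)
  have lw: "length ws = length (leads \<pi>)" using hd_ws by (metis length_map)
  have eta: "eta ws j = (0 # cuts (leads \<pi>)) ! j" for j
    using block_of_descents[OF assms] lw by (simp add: eta_def cuts_def ws_def)
  have rows: "map (\<lambda>j. map (\<lambda>i. hd (ws ! (i - 1))) [eta ws (j - 1) + 1..<eta ws j + 1]) [1..<l + 2]
      = runs (\<le>) (leads \<pi>)"
  proof -
    have "leads \<pi> \<noteq> []" using assms ordered_blocks_ne by simp
    note seg = segments_cuts_runs[OF this]
    show ?thesis
      unfolding seg[symmetric]
    proof (rule nth_equalityI)
      fix i
      assume "i < length (map (\<lambda>j. map (\<lambda>i. hd (ws ! (i - 1))) [eta ws (j - 1) + 1..<eta ws j + 1]) [1..<l + 2])"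
      then have i: "i < Suc l" by (simp del: upt_Suc)
      then have ic: "i < length (cuts (leads \<pi>))" using l by (simp add: length_cuts)
      have "cuts (leads \<pi>) ! i \<le> length ws" using cuts_le[OF nth_mem[OF ic]] lw by simp
      then have "map (\<lambda>i. hd (ws ! (i - 1))) [eta ws i + 1..<eta ws (Suc i) + 1]
          = map (\<lambda>j. map hd ws ! (j - 1)) [eta ws i + 1..<eta ws (Suc i) + 1]"
        by (auto simp: eta simp del: upt_Suc)
      then have "map (\<lambda>i. hd (ws ! (i - 1))) [eta ws i + 1..<eta ws (Suc i) + 1]
          = map (\<lambda>j. leads \<pi> ! (j - 1)) [eta ws i + 1..<eta ws (Suc i) + 1]"
        by (simp only: hd_ws)
      then show "map (\<lambda>j. map (\<lambda>i. hd (ws ! (i - 1))) [eta ws (j - 1) + 1..<eta ws j + 1]) [1..<l + 2] ! i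
        = segments (\<lambda>a d. map (\<lambda>i. leads \<pi> ! (i - 1)) [a + 1..<d + 1]) 0 (cuts (leads \<pi>)) ! i"
        using i ic by (simp add: nth_segments eta del: upt_Suc)
    qed (use l in \<open>simp add: length_cuts del: upt_Suc\<close>)
  qed
  show ?thesis
    unfolding phi_def Let_def ws_def[symmetric] l_def[symmetric] cols rows first Cs_def[symmetric] ..
qed


section \<open>The reading and its bars\<close>

definition col_words :: "nat set list \<Rightarrow> nat list list" where
  "col_words Cs = map (\<lambda>C. rev (sorted_list_of_set C)) (rev Cs)"

definition ribbon_word :: "nat set list \<Rightarrow> nat list" where
  "ribbon_word \<pi> = rev (sorted_list_of_set (hd (col_sets \<pi>))) @ leads \<pi>"

lemma sorted_wrt_rev_sorted_list_of_set: "sorted_wrt (>) (rev (sorted_list_of_set (C :: nat set)))"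
  using sorted_wrt_less_sorted_list_of_set[of C] by (simp add: sorted_wrt_rev)

lemma read_phi_eq:
  assumes "ordered_blocks \<pi>"
  shows "read_tableaux (phi \<pi>) = col_words (tl (col_sets \<pi>)) @ runs (>) (ribbon_word \<pi>)"
proof -
  let ?c = "rev (sorted_list_of_set (hd (col_sets \<pi>)))"
  have ne: "leads \<pi> \<noteq> []" using assms ordered_blocks_ne by simp
  have fin: "finite (hd (col_sets \<pi>))"
    using finite_col_sets[OF assms] col_sets_ne[OF ordered_blocks_ne[OF assms]] by simp
  \<comment> \<open>By \<open>hd_col_sets_greater\<close> the single boxes exceed the first leading
    letter, so all rows are runs of \<open>ribbon_word \<pi>\<close> and
    \<open>ribbon_columns_runs\<close> applies.\<close>
  have "map (\<lambda>x. [x]) ?c @ runs (\<le>) (leads \<pi>) = runs (\<le>) (ribbon_word \<pi>)"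
    unfolding ribbon_word_def
    by (rule runs_descending_append[symmetric, OF sorted_wrt_rev_sorted_list_of_set ne])
      (use hd_col_sets_greater[OF assms] fin in simp)
  then show ?thesis
    unfolding read_tableaux_def phi_eq[OF assms] fst_conv snd_conv ribbon_columns_def[symmetric]
    using ribbon_columns_runs[of "ribbon_word \<pi>"] ne
    by (simp add: col_words_def comp_def ribbon_word_def)
qed

lemma mset_concat_col_words: "mset (concat (col_words Cs)) = content Cs"
  by (induction Cs) (auto simp: col_words_def mset_sorted_list_of_set)

lemma mset_concat_read_phi:
  assumes "ordered_blocks \<pi>"
  shows "mset (concat (read_tableaux (phi \<pi>))) = content \<pi>"
proof -
  obtain X T where XT: "col_sets \<pi> = X # T"
    using col_sets_ne[OF ordered_blocks_ne[OF assms]] by (cases "col_sets \<pi>") auto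
  then show ?thesis
    using content_col_sets[OF assms]
    by (simp add: read_phi_eq[OF assms] concat_runs mset_concat_col_words ribbon_word_def
        mset_sorted_list_of_set add_ac)
qed

lemma ascents_ribbon_word:
  assumes "ordered_blocks \<pi>"
  shows "ascents (ribbon_word \<pi>) = (+) (card (hd (col_sets \<pi>))) ` ascents (leads \<pi>)"
proof -
  have ne: "leads \<pi> \<noteq> []" using assms ordered_blocks_ne by simp
  have fin: "finite (hd (col_sets \<pi>))"
    using finite_col_sets[OF assms] col_sets_ne[OF ordered_blocks_ne[OF assms]] by simp
  show ?thesis
    using ascents_descending_append[OF sorted_wrt_rev_sorted_list_of_set[of "hd (col_sets \<pi>)"] ne]
      hd_col_sets_greater[OF assms] fin by (simp add: ribbon_word_def)
qed

lemma ribbon_word_ne: "ordered_blocks \<pi> \<Longrightarrow> ribbon_word \<pi> \<noteq> []"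
  using ordered_blocks_ne by (simp add: ribbon_word_def)

lemma length_col_words: "length (col_words Cs) = length Cs"
  by (simp add: col_words_def)

lemma card_ascents_leads:
  assumes "ordered_blocks \<pi>"
  shows "Suc (card (ascents (leads \<pi>)) + card (descents (leads \<pi>))) = length \<pi>"
  using card_ascents[of "leads \<pi>"] ordered_blocks_ne[OF assms] by (cases \<pi>) auto

lemma length_runs_ribbon_word:
  "ordered_blocks \<pi> \<Longrightarrow> length (runs (>) (ribbon_word \<pi>)) = Suc (card (ascents (leads \<pi>)))"
  by (simp add: length_runs ribbon_word_ne ascents_ribbon_word card_image)

lemma length_read_phi:
  assumes "ordered_blocks \<pi>"
  shows "length (read_tableaux (phi \<pi>)) = length \<pi>"
  using card_descents_minimaj[OF assms] card_ascents_leads[OF assms] length_runs_ribbon_word[OF assms]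
  by (simp add: read_phi_eq[OF assms] length_col_words)

lemma size_content_ge:
  assumes "ordered_blocks \<pi>"
  shows "length \<pi> \<le> size (content \<pi>)"
  using arg_cong[OF content_col_sets[OF assms], of size] by simp

text \<open>Only columns before the ribbon are shifted: the columns of the ribbon are nonempty and,
  except for the last, end at ascents. The ribbon contains all leading letters, one for each block,
  so the earlier columns end within the first \<open>?N\<close> letters.\<close>

lemma shiftable_read_phi:
  assumes "ordered_blocks \<pi>"
  shows "shiftable (read_tableaux (phi \<pi>)) (size (content \<pi>) - length \<pi>)"
proof
  let ?xs = "col_words (tl (col_sets \<pi>))" and ?v = "ribbon_word \<pi>"
  let ?cs = "runs (>) ?v" and ?N = "size (content \<pi>) - length \<pi>"
  note rd = read_phi_eq[OF assms] and v = ribbon_word_ne[OF assms]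
  have "\<forall>u \<in> set ?cs. sorted_wrt (>) u"
    unfolding decreasing_blocks_iff concat_runs set_bars_runs[OF v] by simp
  then show "\<forall>u \<in> set (read_tableaux (phi \<pi>)). sorted_wrt (>) u"
    by (auto simp: rd col_words_def sorted_wrt_rev_sorted_list_of_set)
  have cs: "?cs \<noteq> []" by (rule runs_ne[OF v])
  have "last ?cs \<in> set ?cs" using cs by (rule last_in_set)
  then have "last ?cs \<noteq> []" using Nil_notin_runs[of "(>)" ?v] by auto
  then show "read_tableaux (phi \<pi>) \<noteq> []" "last (read_tableaux (phi \<pi>)) \<noteq> []"
    using cs by (simp_all add: rd)
  have total: "length (concat (read_tableaux (phi \<pi>))) = size (content \<pi>)"
    using arg_cong[OF mset_concat_read_phi[OF assms], of size] by simp
  then show "length (concat (read_tableaux (phi \<pi>))) = ?N + length (read_tableaux (phi \<pi>))"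
    using size_content_ge[OF assms] length_read_phi[OF assms] by simp
  have xs_le: "length (concat ?xs) \<le> ?N"
    using total by (simp add: rd concat_runs ribbon_word_def del: length_concat)
  fix p assume p: "p \<in> shift_blocks (read_tableaux (phi \<pi>))"
  show "block_end (read_tableaux (phi \<pi>)) p \<le> ?N"
  proof (cases "p \<le> length ?xs")
    case True
    then have "block_end (read_tableaux (phi \<pi>)) p \<le> length (concat ?xs)"
      using block_end_le[of ?xs p] by (simp add: rd block_end_def)
    then show ?thesis using xs_le by simp
  next
    case False
    define r where "r = p - length ?xs"
    have r: "1 \<le> r" "p = length ?xs + r" using False by (auto simp: r_def)
    have rl: "r < length ?cs" using p r by (simp add: shift_blocks_def rd)
    have "read_tableaux (phi \<pi>) ! (p - 1) = ?cs ! (r - 1)"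
    proof -
      have "p - 1 = length ?xs + (r - 1)" using r by simp
      then show ?thesis by (simp only: rd nth_append_length_plus)
    qed
    moreover have "?cs ! (r - 1) \<noteq> []"
    proof -
      have "?cs ! (r - 1) \<in> set ?cs" using rl by (intro nth_mem) simp
      then show ?thesis using Nil_notin_runs[of "(>)" ?v] by auto
    qed
    ultimately have "block_end (read_tableaux (phi \<pi>)) p \<in> descents (concat ?xs @ ?v)"
      using p by (simp add: shift_blocks_def rd concat_runs)
    moreover have "block_end (read_tableaux (phi \<pi>)) p = length (concat ?xs) + block_end ?cs r"
      by (simp add: rd block_end_def r(2) del: length_concat)
    moreover have asc: "block_end ?cs r \<in> ascents ?v"
      unfolding set_bars_runs[OF v, symmetric] bars_def using r rl by simp
    ultimately have "block_end ?cs r \<in> descents ?v"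
      using descents_subset[of "concat ?xs"]
      by (auto simp: descents_append ascents_def split: if_splits simp del: length_concat)
    then show ?thesis using asc by (simp add: ascents_def)
  qed
qed

text \<open>A letter of a column contributes to the sum once for each bar not before it; the
  remaining bars, one for each column to its left, are counted by \<open>weighted_size\<close>. The
  induction varies \<open>ys\<close> because the first set of \<open>Cs\<close> is the column next
  to \<open>ys\<close>.\<close>

lemma sum_list_bars_col_words:
  "ys \<noteq> [] \<Longrightarrow> sum_list (bars (col_words Cs @ ys)) + weighted_size Cs
    = size (content Cs) * (length ys + length Cs - 1) + sum_list (bars ys)"
proof (induction Cs arbitrary: ys)
  case Nil
  then show ?case by (simp add: col_words_def)
next
  case (Cons C Cs)
  have eq: "col_words (C # Cs) @ ys = col_words Cs @ (rev (sorted_list_of_set C) # ys)"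
    by (simp add: col_words_def)
  show ?case
    unfolding eq using Cons.IH[of "rev (sorted_list_of_set C) # ys"]
    by (simp add: sum_list_bars_Cons algebra_simps)
qed

text \<open>Here \<open>W\<close> is the sum of the bars, \<open>x\<close> and \<open>t\<close>
  count the letters of the first and of the other column sets, and \<open>a\<close>,
  \<open>l\<close> the ascents and descents of the leading word. The weights \<open>wT\<close>
  cancel, and \<open>x * l\<close> and \<open>x * a\<close> combine to
  \<open>x * (k - 1)\<close>.\<close>

lemma minimaj_sum_identity:
  fixes M W x t a l :: nat
  assumes "M = SD + x * l + wT" "W + wT = t * (k - 1) + (x * a + SA)" "2 * (SA + SD) + k = k * k"
    "k = Suc (a + l)" "N = x + t"
  shows "2 * (M + W) = (k - 1) * (k + 2 * N)"
proof -
  define j where "j = a + l"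
  have j: "k = Suc j" "k - 1 = j" using assms(4) by (simp_all add: j_def)
  have "2 * (M + W) + k = k * k + 2 * (x * l) + 2 * (t * j) + 2 * (x * a)"
    using assms(1-3) unfolding j(2) by algebra
  then show ?thesis
    unfolding j assms(5) by (simp add: j_def algebra_simps)
qed

lemma minimaj_read_phi:
  assumes "ordered_blocks \<pi>"
  shows "2 * (minimaj \<pi> + sum_list (bars (read_tableaux (phi \<pi>))))
    = (length \<pi> - 1) * (length \<pi> + 2 * (size (content \<pi>) - length \<pi>))"
proof -
  define k N b where "k = length \<pi>" and "N = size (content \<pi>) - length \<pi>" and "b = leads \<pi>"
  obtain X T where XT: "col_sets \<pi> = X # T"
    using col_sets_ne[OF ordered_blocks_ne[OF assms]] by (cases "col_sets \<pi>") auto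
  have len: "length T = card (descents b)" "k = Suc (card (ascents b) + card (descents b))"
    using card_descents_minimaj[OF assms] card_ascents_leads[OF assms] XT by (auto simp: k_def b_def)
  have N: "N = card X + size (content T)"
    using arg_cong[OF content_col_sets[OF assms], of size] XT by (simp add: N_def)
  have mm: "minimaj \<pi> = \<Sum>(descents b) + card X * length T + weighted_size T"
    using minimaj_eq[OF assms] XT by (simp add: b_def)
  have "sum_list (bars (runs (>) (ribbon_word \<pi>))) = card X * card (ascents b) + \<Sum>(ascents b)"
    using sum_list_bars_runs[OF ribbon_word_ne[OF assms]] ascents_ribbon_word[OF assms] XT
    by (simp add: sum_shift b_def)
  then have bars: "sum_list (bars (read_tableaux (phi \<pi>))) + weighted_size T
      = size (content T) * (k - 1) + (card X * card (ascents b) + \<Sum>(ascents b))"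
    using sum_list_bars_col_words[of "runs (>) (ribbon_word \<pi>)" T] read_phi_eq[OF assms] XT len
      length_runs_ribbon_word[OF assms] runs_ne[OF ribbon_word_ne[OF assms], of "(>)"]
    by (simp add: b_def)
  have "\<Sum>(ascents b) + \<Sum>(descents b) = \<Sum>{1..<k}"
    using sum_ascents[of b] by (simp add: b_def k_def)
  moreover have "2 * \<Sum>{1..<j} + j = j * j" for j :: nat
    by (induction j) (auto simp: algebra_simps atLeastLessThanSuc)
  ultimately have "2 * (\<Sum>(ascents b) + \<Sum>(descents b)) + k = k * k" by simp
  from minimaj_sum_identity[OF _ bars this len(2) N] mm len(1) show ?thesis
    by (simp add: N_def k_def)
qed

lemma read_phi_inject:
  assumes "ordered_blocks \<pi>" "ordered_blocks \<pi>'"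
    and eq: "read_tableaux (phi \<pi>) = read_tableaux (phi \<pi>')"
  shows "\<pi> = \<pi>'"
proof -
  note rd = read_phi_eq[OF assms(1)] read_phi_eq[OF assms(2)]
  have len: "length \<pi> = length \<pi>'"
    using length_read_phi assms by metis
  have "concat (col_words (tl (col_sets \<pi>))) @ ribbon_word \<pi>
      = concat (col_words (tl (col_sets \<pi>'))) @ ribbon_word \<pi>'"
    using arg_cong[OF eq, of concat] by (simp add: rd concat_runs)
  then have b: "leads \<pi> = leads \<pi>'"
    using len unfolding ribbon_word_def append_assoc[symmetric]
    by (subst (asm) append_eq_append_conv) simp_all
  have "length (col_words (tl (col_sets \<pi>))) = length (col_words (tl (col_sets \<pi>')))"
    using card_descents_minimaj[OF assms(1)] card_descents_minimaj[OF assms(2)] b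
    by (simp add: length_col_words)
  then have c: "col_words (tl (col_sets \<pi>)) = col_words (tl (col_sets \<pi>'))"
    and r: "runs (>) (ribbon_word \<pi>) = runs (>) (ribbon_word \<pi>')"
    using eq unfolding rd by (simp_all add: append_eq_append_conv)
  have fin: "finite C" if "C \<in> set (col_sets \<pi>) \<union> set (col_sets \<pi>')" for C
    using that finite_col_sets assms by blast
  have ne: "col_sets \<pi> \<noteq> []" "col_sets \<pi>' \<noteq> []"
    using assms col_sets_ne ordered_blocks_ne by blast+
  have tls: "rev (map set (col_words (tl Cs))) = tl Cs" if "\<forall>C \<in> set Cs. finite C" for Cs
    using that by (cases Cs) (auto simp: col_words_def rev_map comp_def intro!: map_idI)
  have "tl (col_sets \<pi>) = rev (map set (col_words (tl (col_sets \<pi>))))"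
    by (rule tls[symmetric]) (use fin in blast)
  also have "\<dots> = tl (col_sets \<pi>')"
    unfolding c by (rule tls) (use fin in blast)
  finally have "tl (col_sets \<pi>) = tl (col_sets \<pi>')" .
  moreover have "ribbon_word \<pi> = ribbon_word \<pi>'" using r by (metis concat_runs)
  then have "sorted_list_of_set (hd (col_sets \<pi>)) = sorted_list_of_set (hd (col_sets \<pi>'))"
    using b by (simp add: ribbon_word_def)
  then have "hd (col_sets \<pi>) = hd (col_sets \<pi>')"
    using fin ne by (metis UnCI hd_in_set sorted_list_of_set.set_sorted_key_list_of_set)
  ultimately have "col_sets \<pi> = col_sets \<pi>'" using ne by (simp add: list.expand)
  then show ?thesis
    using recover_leads_col_sets assms b by metis
qed


subsection \<open>The bijection\<close>

lemma content_map_set: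
  assumes "\<forall>v \<in> set ws. distinct v"
  shows "content (map set ws) = mset (concat ws)"
  using assms by (induction ws) (auto simp: mset_set_set)

lemma set_mset_content: "\<forall>B \<in> set \<pi>. finite B \<Longrightarrow> set_mset (content \<pi>) = \<Union>(set \<pi>)"
  by (induction \<pi>) auto

lemma size_content: "size (content \<pi>) = sum_list (map card \<pi>)"
  by (induction \<pi>) auto

text \<open>Positivity of the letters and their total number depend on the content alone, so a map
  preserving content, length and the finiteness and nonemptiness of blocks preserves
  \<open>OP n k\<close>.\<close>

lemma OP_iff:
  "\<pi> \<in> OP n k \<longleftrightarrow> length \<pi> = k \<and> (\<forall>B \<in> set \<pi>. finite B \<and> B \<noteq> {})
    \<and> 0 \<notin># content \<pi> \<and> size (content \<pi>) = n"
  using set_mset_content[of \<pi>] by (auto simp: OP_def size_content intro: Nat.gr0I)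

lemma ordered_blocks_OP: "\<pi> \<in> OP n k \<Longrightarrow> \<pi> \<noteq> [] \<Longrightarrow> ordered_blocks \<pi>"
  by (simp add: OP_iff ordered_blocks_def)

lemma psi_word_Nil: "psi_word [] = []"
proof -
  \<comment> \<open>For no blocks \<open>phi\<close> still produces one row, which is empty; its
    ribbon has width 0, hence no columns.\<close>
  have "phi [] = ([], [[]])"
    by (simp add: phi_def Let_def nonleading_def delta_def eta_def descents_sorted)
  then have "read_tableaux (phi []) = []"
    by (simp add: read_tableaux_def ribbon_width_def)
  then show ?thesis
    by (simp add: psi_word_def left_shift_def shift_blocks_def)
qed

lemma psi_ordered_blocks:
  assumes "ordered_blocks \<pi>"
  shows "psi_word \<pi> = major_index_order (psi \<pi>)" "content (psi \<pi>) = content \<pi>"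
    "length (psi \<pi>) = length \<pi>" "\<forall>B \<in> set (psi \<pi>). finite B \<and> B \<noteq> {}" "minimaj \<pi> = maj (psi \<pi>)"
proof -
  interpret shiftable "read_tableaux (phi \<pi>)" "size (content \<pi>) - length \<pi>"
    by (rule shiftable_read_phi[OF assms])
  have pw: "psi_word \<pi> = left_shift (read_tableaux (phi \<pi>))" "psi \<pi> = map set (left_shift (read_tableaux (phi \<pi>)))"
    by (simp_all add: psi_word_def psi_def)
  show "psi_word \<pi> = major_index_order (psi \<pi>)"
    unfolding pw using major_index_order_map_set[OF left_shift_decreasing] by simp
  have "distinct v" if "v \<in> set (left_shift (read_tableaux (phi \<pi>)))" for v
  proof -
    have "sorted_wrt (<) (rev v)" using left_shift_decreasing that by (simp add: sorted_wrt_rev)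
    then show ?thesis using strict_sorted_iff[of "rev v"] by simp
  qed
  then show "content (psi \<pi>) = content \<pi>"
    unfolding pw using mset_concat_read_phi[OF assms] left_shift(2) by (simp add: content_map_set)
  show "length (psi \<pi>) = length \<pi>"
    unfolding pw using left_shift(1) length_read_phi[OF assms] by simp
  show "\<forall>B \<in> set (psi \<pi>). finite B \<and> B \<noteq> {}"
    unfolding pw using left_shift_nonempty by auto
  show "minimaj \<pi> = maj (psi \<pi>)"
    using maj_left_shift minimaj_read_phi[OF assms] length_read_phi[OF assms] unfolding pw by simp
qed

lemma psi_inject:
  assumes "ordered_blocks \<pi>" "ordered_blocks \<pi>'" "psi \<pi> = psi \<pi>'"
  shows "\<pi> = \<pi>'"
proof -
  have "psi_word \<pi> = psi_word \<pi>'"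
    using psi_ordered_blocks(1) assms by metis
  then have "read_tableaux (phi \<pi>) = read_tableaux (phi \<pi>')"
    using left_shift_inject[OF shiftable_read_phi[OF assms(1)] shiftable_read_phi[OF assms(2)]]
    by (simp add: psi_word_def)
  then show ?thesis using read_phi_inject assms by blast
qed

lemma psi_OP:
  assumes "\<pi> \<in> OP n k"
  shows "psi_word \<pi> = major_index_order (psi \<pi>)" "content (psi \<pi>) = content \<pi>"
    "psi \<pi> \<in> OP n k" "minimaj \<pi> = maj (psi \<pi>)"
proof -
  have "psi_word \<pi> = major_index_order (psi \<pi>) \<and> content (psi \<pi>) = content \<pi> \<and>
    psi \<pi> \<in> OP n k \<and> minimaj \<pi> = maj (psi \<pi>)"
  proof (cases "\<pi> = []")
    case True
    then show ?thesis
      using assms psi_word_Nil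
      by (simp add: psi_def major_index_order_def minimaj_def maj_def descents_sorted)
  next
    case False
    note ob = ordered_blocks_OP[OF assms False]
    show ?thesis
      using psi_ordered_blocks[OF ob] assms by (simp add: OP_iff)
  qed
  then show "psi_word \<pi> = major_index_order (psi \<pi>)" "content (psi \<pi>) = content \<pi>"
    "psi \<pi> \<in> OP n k" "minimaj \<pi> = maj (psi \<pi>)" by blast+
qed

lemma inj_on_psi: "inj_on psi (OP n k)"
proof (rule inj_onI)
  fix \<pi> \<pi>' assume \<pi>: "\<pi> \<in> OP n k" and \<pi>': "\<pi>' \<in> OP n k" and eq: "psi \<pi> = psi \<pi>'"
  show "\<pi> = \<pi>'"
  proof (cases "k = 0")
    case True
    then show ?thesis using \<pi> \<pi>' by (simp add: OP_def)
  next
    case False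
    then have "\<pi> \<noteq> []" "\<pi>' \<noteq> []" using \<pi> \<pi>' by (auto simp: OP_def)
    then show ?thesis
      using psi_inject[OF ordered_blocks_OP[OF \<pi>] ordered_blocks_OP[OF \<pi>'] eq] by simp
  qed
qed

lemma finite_OP_content: "finite {\<pi> \<in> OP n k. content \<pi> = \<alpha>}"
proof (rule finite_subset)
  show "{\<pi> \<in> OP n k. content \<pi> = \<alpha>} \<subseteq> {\<pi>. set \<pi> \<subseteq> Pow (set_mset \<alpha>) \<and> length \<pi> = k}"
    using set_mset_content by (auto simp: OP_iff)
  show "finite {\<pi>. set \<pi> \<subseteq> Pow (set_mset \<alpha>) \<and> length \<pi> = k}"
    by (rule finite_lists_length_eq) simp
qed

lemma bij_betw_psi: "bij_betw psi (OP n k) (OP n k)"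
proof -
  have "\<sigma> \<in> psi ` OP n k" if "\<sigma> \<in> OP n k" for \<sigma>
  proof -
    let ?F = "{\<pi> \<in> OP n k. content \<pi> = content \<sigma>}"
    have "psi ` ?F = ?F"
      by (rule endo_inj_surj[OF finite_OP_content _ inj_on_subset[OF inj_on_psi]])
        (use psi_OP in auto)
    then show ?thesis using that by blast
  qed
  then show ?thesis
    using inj_on_psi psi_OP(3) by (auto simp: bij_betw_def)
qed

text \<open>The predicate \<open>P\<close> allows both uses below: no condition on the content, or a
  prescribed content.\<close>

lemma bij_betw_psi_restrict:
  "bij_betw psi {\<pi> \<in> OP n k. P (content \<pi>) \<and> minimaj \<pi> = d} {\<pi> \<in> OP n k. P (content \<pi>) \<and> maj \<pi> = d}"
proof (rule bij_betw_imageI)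
  show "inj_on psi {\<pi> \<in> OP n k. P (content \<pi>) \<and> minimaj \<pi> = d}"
    by (rule inj_on_subset[OF inj_on_psi]) auto
  show "psi ` {\<pi> \<in> OP n k. P (content \<pi>) \<and> minimaj \<pi> = d} = {\<pi> \<in> OP n k. P (content \<pi>) \<and> maj \<pi> = d}"
  proof
    show "psi ` {\<pi> \<in> OP n k. P (content \<pi>) \<and> minimaj \<pi> = d} \<subseteq> {\<pi> \<in> OP n k. P (content \<pi>) \<and> maj \<pi> = d}"
      using psi_OP by auto
    show "{\<pi> \<in> OP n k. P (content \<pi>) \<and> maj \<pi> = d} \<subseteq> psi ` {\<pi> \<in> OP n k. P (content \<pi>) \<and> minimaj \<pi> = d}"
    proof
      fix \<sigma> assume \<sigma>: "\<sigma> \<in> {\<pi> \<in> OP n k. P (content \<pi>) \<and> maj \<pi> = d}"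
      then obtain \<pi> where "\<pi> \<in> OP n k" "\<sigma> = psi \<pi>"
        using bij_betw_imp_surj_on[OF bij_betw_psi, of n k] by blast
      then show "\<sigma> \<in> psi ` {\<pi> \<in> OP n k. P (content \<pi>) \<and> minimaj \<pi> = d}"
        using \<sigma> psi_OP by auto
    qed
  qed
qed

text \<open>Equidistribution is stated twice. Letters are unbounded, so the level sets may be
  infinite and are compared by equipollence; within a fixed content they are finite and
  \<open>card\<close> is meaningful.\<close>

theorem theorem5p12:
  fixes n k :: nat
  shows "bij_betw psi (OP n k) (OP n k)
    \<and> (\<forall>\<pi> \<in> OP n k. psi_word \<pi> = major_index_order (psi \<pi>))
    \<and> (\<forall>\<pi> \<in> OP n k. minimaj \<pi> = maj (psi \<pi>))
    \<and> (\<forall>d. {\<pi> \<in> OP n k. minimaj \<pi> = d} \<approx> {\<pi> \<in> OP n k. maj \<pi> = d})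
    \<and> (\<forall>\<alpha> d. card {\<pi> \<in> OP n k. content \<pi> = \<alpha> \<and> minimaj \<pi> = d}
            = card {\<pi> \<in> OP n k. content \<pi> = \<alpha> \<and> maj \<pi> = d})"
proof (intro conjI allI ballI)
  show "{\<pi> \<in> OP n k. minimaj \<pi> = d} \<approx> {\<pi> \<in> OP n k. maj \<pi> = d}" for d
    unfolding eqpoll_def using bij_betw_psi_restrict[of n k "\<lambda>_. True" d] by auto
  show "card {\<pi> \<in> OP n k. content \<pi> = \<alpha> \<and> minimaj \<pi> = d}
      = card {\<pi> \<in> OP n k. content \<pi> = \<alpha> \<and> maj \<pi> = d}" for \<alpha> d
    by (rule bij_betw_same_card[OF bij_betw_psi_restrict])
qed (simp_all add: bij_betw_psi psi_OP)


end
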